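(* Let $\mathcal{C}$ be a hereditary class of graphs. Then the following are equivalent: (i) $\mathcal{C}$ admits a sub-linear bound on twin-width, i.e. there is a function $g : \mathbb{N} \to \mathbb{R}_{\ge 0}$ with $g(n) \in o(n)$ such that $\operatorname{tww}(G) \leq g(|V(G)|)$ for every $G \in \mathcal{C}$; (ii) $\mathcal{C}$ has bounded VC-dimension, i.e. there is $k \in \mathbb{N}$ such that $\operatorname{vcdim}(G) \leq k$ for every $G \in \mathcal{C}$.
   Context: All graphs are finite, simple and undirected. A class of graphs is hereditary if it is closed under isomorphism and under taking induced subgraphs. VC-dimension: for a set $\mathcal{F}$ of subsets of a finite ground set $V$, a subset $S \subseteq V$ is shattered by $\mathcal{F}$ if for every $A \subseteq S$ there exists $B \in \mathcal{F}$ with $B \cap S = A$. The VC-dimension of $\mathcal{F}$ is the largest cardinality of a subset of $V$ shattered by $\mathcal{F}$. The VC-dimension $\operatorname{vcdim}(G)$ of a graph $G$ is the VC-dimension of the set $\{N(v) : v \in V(G)\}$ of (open) neighbourhoods, with ground set $V(G)$. Twin-width: a trigraph is a graph together with a partition of its edge-set into black edges and red edges; an ordinary graph is regarded as a trigraph with all edges black. Contracting two distinct (not necessarily adjacent) vertices $u,v$ of a trigraph means replacing them by a single new vertex $w$ such that, for every other vertex $x$: $wx$ is a black edge if both $ux$ and $vx$ are black edges; $wx$ is a non-edge if neither $ux$ nor $vx$ is an edge; and $wx$ is a red edge otherwise. All other edges and their colours are unchanged. The red degree of a vertex is the number of red edges incident with it. A contraction sequence of an $n$-vertex graph $G$ is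 a sequence of trigraphs $G = G_n, \dots, G_1 = K_1$ where each $G_s$ is obtained from $G_{s+1}$ by one contraction; it is a $d$-sequence if every trigraph in it has maximum red degree at most $d$. The twin-width $\operatorname{tww}(G)$ is the minimum integer $d$ such that $G$ has a $d$-sequence. *)

theory Defs
  imports
    Complex_Main
    "HOL-Library.Infinite_Typeclass"
    "HOL-Library.Landau_Symbols"
begin

record 'a graph =
  verts :: "'a set"
  edges :: "'a set set"

(* The null graph is excluded: neither its twin-width (a contraction sequence ends in a
   one-vertex graph) nor its VC-dimension (the empty family shatters no set) is defined. *)
definition is_graph :: "'a graph \<Rightarrow> bool" where
  "is_graph G \<longleftrightarrow> finite (verts G) \<and> verts G \<noteq> {} \<and>
     (\<forall>e\<in>edges G. e \<subseteq> verts G \<and> card e = 2)"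

definition graph_iso :: "'a graph \<Rightarrow> 'b graph \<Rightarrow> bool" where
  "graph_iso G H \<longleftrightarrow> (\<exists>f. bij_betw f (verts G) (verts H) \<and>
     (\<forall>u\<in>verts G. \<forall>v\<in>verts G. {u, v} \<in> edges G \<longleftrightarrow> {f u, f v} \<in> edges H))"

definition induced :: "'a graph \<Rightarrow> 'a set \<Rightarrow> 'a graph" where
  "induced G X = \<lparr>verts = X, edges = {e \<in> edges G. e \<subseteq> X}\<rparr>"

(* Over an infinite vertex type every finite graph has an isomorphic copy, so these sets
   represent all isomorphism-closed classes of finite graphs. *)
definition hereditary :: "'a::infinite graph set \<Rightarrow> bool" where
  "hereditary C \<longleftrightarrow>
     (\<forall>G\<in>C. is_graph G) \<and>
     (\<forall>G\<in>C. \<forall>H. is_graph H \<and> graph_iso G H \<longrightarrow> H \<in> C) \<and>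
     (\<forall>G\<in>C. \<forall>X. X \<subseteq> verts G \<and> X \<noteq> {} \<longrightarrow> induced G X \<in> C)"

definition neighbourhood :: "'a graph \<Rightarrow> 'a \<Rightarrow> 'a set" where
  "neighbourhood G v = {x \<in> verts G. {v, x} \<in> edges G}"

definition shattered :: "'a set set \<Rightarrow> 'a set \<Rightarrow> bool" where
  "shattered F S \<longleftrightarrow> (\<forall>A. A \<subseteq> S \<longrightarrow> (\<exists>B\<in>F. B \<inter> S = A))"

definition vc_dimension :: "'a set \<Rightarrow> 'a set set \<Rightarrow> nat" where
  "vc_dimension V F = Max (card ` {S. S \<subseteq> V \<and> shattered F S})"

definition vcdim :: "'a graph \<Rightarrow> nat" where
  "vcdim G = vc_dimension (verts G) (neighbourhood G ` verts G)"

record 'a trigraph =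
  tverts :: "'a set"
  black :: "'a set set"
  red :: "'a set set"

definition trigraph_of :: "'a graph \<Rightarrow> 'a trigraph" where
  "trigraph_of G = \<lparr>tverts = verts G, black = edges G, red = {}\<rparr>"

definition contract :: "'a trigraph \<Rightarrow> 'a \<Rightarrow> 'a \<Rightarrow> 'a \<Rightarrow> 'a trigraph" where
  "contract T u v w =
     \<lparr>tverts = insert w (tverts T - {u, v}),
      black = {e \<in> black T. u \<notin> e \<and> v \<notin> e} \<union>
        {{w, x} | x. x \<in> tverts T - {u, v} \<and> {u, x} \<in> black T \<and> {v, x} \<in> black T},
      red = {e \<in> red T. u \<notin> e \<and> v \<notin> e} \<union>
        {{w, x} | x. x \<in> tverts T - {u, v} \<and>
           \<not> ({u, x} \<in> black T \<and> {v, x} \<in> black T) \<and>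
           \<not> ({u, x} \<notin> black T \<union> red T \<and> {v, x} \<notin> black T \<union> red T)}\<rparr>"

definition contraction :: "'a trigraph \<Rightarrow> 'a trigraph \<Rightarrow> bool" where
  "contraction T T' \<longleftrightarrow> (\<exists>u v w. u \<in> tverts T \<and> v \<in> tverts T \<and> u \<noteq> v \<and>
     w \<notin> tverts T \<and> T' = contract T u v w)"

definition red_degree :: "'a trigraph \<Rightarrow> 'a \<Rightarrow> nat" where
  "red_degree T v = card {e \<in> red T. v \<in> e}"

(* S s is the s-vertex trigraph of the sequence; values of S outside {1..n} are irrelevant. *)
definition contraction_sequence :: "'a graph \<Rightarrow> (nat \<Rightarrow> 'a trigraph) \<Rightarrow> bool" where
  "contraction_sequence G S \<longleftrightarrow>
     S (card (verts G)) = trigraph_of G \<and>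
     (\<exists>x. S 1 = \<lparr>tverts = {x}, black = {}, red = {}\<rparr>) \<and>
     (\<forall>s\<in>{1..<card (verts G)}. contraction (S (s + 1)) (S s))"

definition is_d_sequence :: "nat \<Rightarrow> 'a graph \<Rightarrow> (nat \<Rightarrow> 'a trigraph) \<Rightarrow> bool" where
  "is_d_sequence d G S \<longleftrightarrow> contraction_sequence G S \<and>
     (\<forall>s\<in>{1..card (verts G)}. \<forall>v\<in>tverts (S s). red_degree (S s) v \<le> d)"

(* The infinite vertex type supplies a new vertex for every contraction, so some d works. *)
definition tww :: "'a::infinite graph \<Rightarrow> nat" where
  "tww G = (LEAST d. \<exists>S. is_d_sequence d G S)"

end

(* If p vertices all have neighbourhoods close to that of a common centre, contracting them
   one by one produces few red edges: a red neighbour of the growing part is either a vertex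
   separating two of the p vertices, or one of the at most n/p parts that are no longer
   singletons. Bounded VC-dimension yields, by Sauer-Shelah and a greedy sample, a bounded
   number of clusters of radius delta n; cutting them into chunks of size p leaves n/p + O(1)
   parts, so twin-width is at most n/p + O(1) + p delta n.
   Conversely, a shattered set of size 2^m gives vertices a X, b Y for X, Y in Pow {..<m},
   adjacent iff card (X Int Y) is odd. Any two rows, and any two columns, of this matrix
   differ in half of the positions, which forces linear twin-width. *)

theory Submission
  imports Defs
begin

subsection \<open>Quotient trigraphs\<close>

text \<open>Whatever the order of contractions, two parts are joined in red exactly when the pair is
  neither complete nor empty in \<open>G\<close>. Every trigraph of a sequence is therefore handled
  as the quotient of \<open>G\<close> by a labelling \<open>p\<close>, and red degrees are read off
  from \<open>G\<close>. Whole clusters cannot be contracted blindly: the separators from the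
  centre, united over a large cluster, may cover all vertices. This is what chunks of bounded size
  prevent. The chunk size is fixed first and the radius \<delta> after it; the number of clusters
  then depends only on \<delta> and the VC-dimension, so a large order absorbs it. The lower bound
  must defeat every sequence, and the first harmful contraction may happen on either side of the
  matrix. Hence rows and columns must both be far apart; the parity pattern is symmetric, so one
  computation covers both. Heredity matters because a graph may be far larger than its shattered
  set: linear twin-width has to be measured in the small induced subgraph on the chosen
  vertices.\<close>

abbreviation adj :: "'a graph \<Rightarrow> 'a \<Rightarrow> 'a \<Rightarrow> bool" where
  "adj G u v \<equiv> {u, v} \<in> edges G"

lemma adj_commute: "adj G u v \<longleftrightarrow> adj G v u"
  by (simp add: insert_commute)

definition pairs :: "'b set \<Rightarrow> ('b \<Rightarrow> 'b \<Rightarrow> bool) \<Rightarrow> 'b set set" where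
  "pairs T R = {{x, y} | x y. x \<in> T \<and> y \<in> T \<and> x \<noteq> y \<and> R x y}"

lemma pair_in_pairs_iff:
  assumes "\<And>x y. R x y = R y x"
  shows "{x, y} \<in> pairs T R \<longleftrightarrow> x \<in> T \<and> y \<in> T \<and> x \<noteq> y \<and> R x y"
  unfolding pairs_def using assms by (auto simp: doubleton_eq_iff)

definition complete_between :: "'a graph \<Rightarrow> ('a \<Rightarrow> 'b) \<Rightarrow> 'b \<Rightarrow> 'b \<Rightarrow> bool" where
  "complete_between G p x y \<longleftrightarrow>
     (\<forall>u\<in>verts G. \<forall>v\<in>verts G. p u = x \<longrightarrow> p v = y \<longrightarrow> adj G u v)"

definition empty_between :: "'a graph \<Rightarrow> ('a \<Rightarrow> 'b) \<Rightarrow> 'b \<Rightarrow> 'b \<Rightarrow> bool" where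
  "empty_between G p x y \<longleftrightarrow>
     (\<forall>u\<in>verts G. \<forall>v\<in>verts G. p u = x \<longrightarrow> p v = y \<longrightarrow> \<not> adj G u v)"

text \<open>Colours after any number of contractions depend only on the current partition, so a
  labelling replaces nested applications of \<open>contract\<close>. Labels are arbitrary names,
  which leaves room for the new vertex of each contraction.\<close>

definition quotient_trigraph :: "'a graph \<Rightarrow> ('a \<Rightarrow> 'b) \<Rightarrow> 'b trigraph" where
  "quotient_trigraph G p = \<lparr>tverts = p ` verts G,
     black = pairs (p ` verts G) (complete_between G p),
     red = pairs (p ` verts G) (\<lambda>x y. \<not> complete_between G p x y \<and> \<not> empty_between G p x y)\<rparr>"

definition merge :: "('a \<Rightarrow> 'b) \<Rightarrow> 'b \<Rightarrow> 'b \<Rightarrow> 'b \<Rightarrow> 'a \<Rightarrow> 'b" where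
  "merge p u v w = (\<lambda>x. if p x = u \<or> p x = v then w else p x)"

lemma complete_between_commute: "complete_between G p x y = complete_between G p y x"
  unfolding complete_between_def by (metis adj_commute)

lemma empty_between_commute: "empty_between G p x y = empty_between G p y x"
  unfolding empty_between_def by (metis adj_commute)

lemma black_quotient_iff:
  "{x, y} \<in> black (quotient_trigraph G p) \<longleftrightarrow>
     x \<in> p ` verts G \<and> y \<in> p ` verts G \<and> x \<noteq> y \<and> complete_between G p x y"
  unfolding quotient_trigraph_def
  by (simp add: pair_in_pairs_iff complete_between_commute)

lemma red_quotient_iff:
  "{x, y} \<in> red (quotient_trigraph G p) \<longleftrightarrow>
     x \<in> p ` verts G \<and> y \<in> p ` verts G \<and> x \<noteq> y \<and>
     \<not> complete_between G p x y \<and> \<not> empty_between G p x y"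
  unfolding quotient_trigraph_def
  using pair_in_pairs_iff[where R="\<lambda>x y. \<not> complete_between G p x y \<and> \<not> empty_between G p x y"]
    complete_between_commute[of G p] empty_between_commute[of G p] by auto

lemma tverts_quotient [simp]: "tverts (quotient_trigraph G p) = p ` verts G"
  by (simp add: quotient_trigraph_def)

lemma not_complete_and_empty:
  assumes "x \<in> p ` verts G" "y \<in> p ` verts G" "complete_between G p x y"
  shows "\<not> empty_between G p x y"
  using assms unfolding complete_between_def empty_between_def by blast

text \<open>\<open>contract\<close> updates black and red edges by the same pattern; abstract
  relations \<open>R\<close>, \<open>R'\<close>, \<open>Q\<close> let one argument serve both
  colours.\<close>

lemma pairs_contract:
  assumes uv: "u \<in> T" "v \<in> T" "u \<noteq> v" and w: "w \<notin> T"
    and sym: "\<And>x y. R' x y = R' y x"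
    and old: "\<And>x y. x \<in> T - {u, v} \<Longrightarrow> y \<in> T - {u, v} \<Longrightarrow> R' x y = R x y"
    and new: "\<And>x. x \<in> T - {u, v} \<Longrightarrow> R' w x = Q x"
  shows "{e \<in> pairs T R. u \<notin> e \<and> v \<notin> e} \<union> {{w, x} | x. x \<in> T - {u, v} \<and> Q x} =
         pairs (insert w (T - {u, v})) R'" (is "?L = ?R")
proof
  show "?L \<subseteq> ?R"
  proof
    fix e assume "e \<in> ?L"
    then consider (a) "e \<in> pairs T R" "u \<notin> e" "v \<notin> e"
      | (b) x where "e = {w, x}" "x \<in> T - {u, v}" "Q x" by blast
    then show "e \<in> ?R"
    proof cases
      case a
      then obtain x y where "e = {x, y}" "x \<in> T" "y \<in> T" "x \<noteq> y" "R x y"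
        by (auto simp: pairs_def)
      with a old[of x y] show ?thesis unfolding pairs_def by blast
    next
      case b
      with w new[of x] have "R' w x" "w \<noteq> x" by auto
      with b show ?thesis unfolding pairs_def by blast
    qed
  qed
next
  show "?R \<subseteq> ?L"
  proof
    fix e assume "e \<in> ?R"
    then obtain x y where e: "e = {x, y}" "x \<in> insert w (T - {u, v})"
      "y \<in> insert w (T - {u, v})" "x \<noteq> y" "R' x y" by (auto simp: pairs_def)
    consider "x = w" "y \<in> T - {u, v}" | "y = w" "x \<in> T - {u, v}" | "x \<in> T - {u, v}" "y \<in> T - {u, v}"
      using e by blast
    then show "e \<in> ?L"
    proof cases
      case 1 then show ?thesis using e new[of y] by blast
    next
      case 2 then show ?thesis using e new[of x] sym[of x y] by (auto simp: insert_commute)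
    next
      case 3
      then have "e \<in> pairs T R" using e old[of x y] unfolding pairs_def by blast
      with 3 e show ?thesis by blast
    qed
  qed
qed

lemma image_merge:
  assumes "u \<in> p ` A" "v \<in> p ` A"
  shows "merge p u v w ` A = insert w (p ` A - {u, v})"
  using assms unfolding merge_def by (auto simp: image_iff)

text \<open>The merged part is complete to \<open>x\<close> iff both old parts are, and empty to
  \<open>x\<close> iff both are. These are the rules for black edges and non-edges in
  \<open>contract\<close>, and red is what remains in both descriptions.\<close>

lemma contract_quotient:
  assumes uv: "u \<in> p ` verts G" "v \<in> p ` verts G" "u \<noteq> v" and w: "w \<notin> p ` verts G"
  shows "contract (quotient_trigraph G p) u v w = quotient_trigraph G (merge p u v w)"
proof -
  let ?T = "p ` verts G" and ?q = "merge p u v w"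
  let ?red = "\<lambda>p x y. \<not> complete_between G p x y \<and> \<not> empty_between G p x y"
  have im: "?q ` verts G = insert w (?T - {u, v})"
    by (rule image_merge[OF uv(1,2)])
  have w': "p x \<noteq> w" if "x \<in> verts G" for x using w that by auto
  have qold: "?q x = y \<longleftrightarrow> p x = y" if "x \<in> verts G" "y \<in> ?T - {u, v}" for x y
    using that w w' by (auto simp: merge_def)
  have qw: "?q x = w \<longleftrightarrow> p x = u \<or> p x = v" if "x \<in> verts G" for x
    using that w' by (auto simp: merge_def)
  have c_old: "complete_between G ?q x y = complete_between G p x y"
    "empty_between G ?q x y = empty_between G p x y"
    if "x \<in> ?T - {u, v}" "y \<in> ?T - {u, v}" for x y
    using qold that unfolding complete_between_def empty_between_def by metis+
  have c_new: "complete_between G ?q w x \<longleftrightarrow> complete_between G p u x \<and> complete_between G p v x"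
    "empty_between G ?q w x \<longleftrightarrow> empty_between G p u x \<and> empty_between G p v x"
    if "x \<in> ?T - {u, v}" for x
    using that unfolding complete_between_def empty_between_def by (auto simp: qold qw)
  \<comment> \<open>Parts are nonempty, so complete and empty exclude each other; being neither
    black nor red thus means exactly being empty.\<close>
  have b: "{y, x} \<in> black (quotient_trigraph G p) \<longleftrightarrow> complete_between G p y x"
    "{y, x} \<notin> black (quotient_trigraph G p) \<union> red (quotient_trigraph G p) \<longleftrightarrow> empty_between G p y x"
    if "x \<in> ?T - {u, v}" "y = u \<or> y = v" for x y
    using that uv not_complete_and_empty[of y p G x] 
    by (auto simp: black_quotient_iff red_quotient_iff)
  have "black (contract (quotient_trigraph G p) u v w) = black (quotient_trigraph G ?q)"
  proof -
    have "{{w, x} | x. x \<in> ?T - {u, v} \<and> {u, x} \<in> black (quotient_trigraph G p) \<and>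
             {v, x} \<in> black (quotient_trigraph G p)} =
          {{w, x} | x. x \<in> ?T - {u, v} \<and> complete_between G p u x \<and> complete_between G p v x}"
      using b by blast
    moreover have "{e \<in> pairs ?T (complete_between G p). u \<notin> e \<and> v \<notin> e} \<union>
          {{w, x} | x. x \<in> ?T - {u, v} \<and> complete_between G p u x \<and> complete_between G p v x}
        = pairs (insert w (?T - {u, v})) (complete_between G ?q)"
      by (rule pairs_contract[OF uv w complete_between_commute]) (use c_old c_new in auto)
    ultimately show ?thesis
      by (simp add: contract_def quotient_trigraph_def im)
  qed
  moreover have "red (contract (quotient_trigraph G p) u v w) = red (quotient_trigraph G ?q)"
  proof -
    have "{{w, x} | x. x \<in> ?T - {u, v} \<and>
             \<not> ({u, x} \<in> black (quotient_trigraph G p) \<and> {v, x} \<in> black (quotient_trigraph G p)) \<and>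
             \<not> ({u, x} \<notin> black (quotient_trigraph G p) \<union> red (quotient_trigraph G p) \<and>
                {v, x} \<notin> black (quotient_trigraph G p) \<union> red (quotient_trigraph G p))} =
          {{w, x} | x. x \<in> ?T - {u, v} \<and> ?red ?q w x}"
      by (rule Collect_cong) (metis b c_new)
    moreover have "{e \<in> pairs ?T (?red p). u \<notin> e \<and> v \<notin> e} \<union>
          {{w, x} | x. x \<in> ?T - {u, v} \<and> ?red ?q w x}
        = pairs (insert w (?T - {u, v})) (?red ?q)"
      by (rule pairs_contract[OF uv w])
        (use c_old complete_between_commute[of G ?q] empty_between_commute[of G ?q] in auto)
    ultimately show ?thesis
      by (simp add: contract_def quotient_trigraph_def im)
  qed
  moreover have "tverts (contract (quotient_trigraph G p) u v w) = tverts (quotient_trigraph G ?q)"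
    by (simp add: contract_def im)
  ultimately show ?thesis by simp
qed

lemma trigraph_of_eq_quotient:
  assumes "is_graph G"
  shows "trigraph_of G = quotient_trigraph G (\<lambda>x. x)"
proof -
  have "edges G = pairs (verts G) (adj G)"
  proof -
    have "e \<in> pairs (verts G) (adj G)" if "e \<in> edges G" for e
    proof -
      from that assms have "card e = 2" "e \<subseteq> verts G" by (auto simp: is_graph_def)
      then obtain x y where "e = {x, y}" "x \<noteq> y" by (auto simp: card_2_iff)
      with that \<open>e \<subseteq> verts G\<close> show ?thesis unfolding pairs_def by blast
    qed
    then show ?thesis by (auto simp: pairs_def)
  qed
  moreover have "pairs (verts G) (complete_between G (\<lambda>x. x)) = pairs (verts G) (adj G)"
    unfolding pairs_def complete_between_def by blast
  moreover have "pairs (verts G) (\<lambda>x y. \<not> complete_between G (\<lambda>x. x) x y \<and>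
      \<not> empty_between G (\<lambda>x. x) x y) = {}"
    unfolding pairs_def complete_between_def empty_between_def by blast
  ultimately show ?thesis
    by (simp add: trigraph_of_def quotient_trigraph_def)
qed

lemma red_edge_cases:
  assumes "e \<in> red (quotient_trigraph G p)" "x \<in> e"
  obtains y where "e = {x, y}" "y \<in> p ` verts G" "x \<noteq> y"
    "\<not> complete_between G p x y" "\<not> empty_between G p x y"
  using assms complete_between_commute[of G p x] empty_between_commute[of G p x]
  by (auto simp: quotient_trigraph_def pairs_def insert_commute)

lemma red_degree_quotient:
  "red_degree (quotient_trigraph G p) x =
     card {y \<in> p ` verts G. {x, y} \<in> red (quotient_trigraph G p)}" (is "_ = card ?N")
proof -
  have "{e \<in> red (quotient_trigraph G p). x \<in> e} = (\<lambda>y. {x, y}) ` ?N" (is "?E = _")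
  proof
    show "?E \<subseteq> (\<lambda>y. {x, y}) ` ?N"
    proof
      fix e assume "e \<in> ?E"
      then have "e \<in> red (quotient_trigraph G p)" "x \<in> e" by auto
      then obtain y where "e = {x, y}" "y \<in> p ` verts G" by (rule red_edge_cases)
      with \<open>e \<in> ?E\<close> show "e \<in> (\<lambda>y. {x, y}) ` ?N" by blast
    qed
  qed auto
  moreover have "inj_on (\<lambda>y. {x, y}) ?N"
    by (auto simp: inj_on_def doubleton_eq_iff)
  ultimately show ?thesis
    unfolding red_degree_def by (simp add: card_image)
qed

subsection \<open>Contracting the classes of a partition\<close>

text \<open>The tail of a \<open>d\<close>-sequence that starts at the partition of
  \<open>p\<close>. Tails allow induction on the number of parts; for the identity labelling the
  tail is a \<open>d\<close>-sequence of \<open>G\<close>.\<close>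

definition reducible :: "nat \<Rightarrow> 'a graph \<Rightarrow> ('a \<Rightarrow> 'a) \<Rightarrow> bool" where
  "reducible d G p \<longleftrightarrow> (\<exists>S. S (card (p ` verts G)) = quotient_trigraph G p \<and>
     (\<exists>x. S 1 = \<lparr>tverts = {x}, black = {}, red = {}\<rparr>) \<and>
     (\<forall>s\<in>{1..<card (p ` verts G)}. contraction (S (s + 1)) (S s)) \<and>
     (\<forall>s\<in>{1..card (p ` verts G)}. \<forall>v\<in>tverts (S s). red_degree (S s) v \<le> d))"

lemma card_image_merge:
  assumes "finite A" "u \<in> p ` A" "v \<in> p ` A" "u \<noteq> v" "w \<notin> p ` A"
  shows "card (p ` A) = Suc (card (merge p u v w ` A))" "merge p u v w ` A \<noteq> {}"
proof -
  have "{u, v} \<subseteq> p ` A" using assms by auto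
  then have "card (p ` A - {u, v}) = card (p ` A) - 2" "2 \<le> card (p ` A)"
    using assms card_mono[of "p ` A" "{u, v}"] by (auto simp: card_Diff_subset)
  then show "card (p ` A) = Suc (card (merge p u v w ` A))"
    using assms by (simp add: image_merge[OF assms(2,3)])
  show "merge p u v w ` A \<noteq> {}" using assms by auto
qed

lemma reducible_singleton:
  assumes "card (p ` verts G) = 1"
  shows "reducible d G p"
proof -
  obtain x where x: "p ` verts G = {x}" using assms card_1_singletonE by blast
  have "pairs {x} R = {}" for R by (auto simp: pairs_def)
  then have "quotient_trigraph G p = \<lparr>tverts = {x}, black = {}, red = {}\<rparr>"
    by (simp add: quotient_trigraph_def x)
  then show ?thesis unfolding reducible_def
    by (intro exI[of _ "\<lambda>_. quotient_trigraph G p"]) (auto simp: x red_degree_def)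
qed

lemma reducible_merge:
  assumes "finite (verts G)" "u \<in> p ` verts G" "v \<in> p ` verts G" "u \<noteq> v" "w \<notin> p ` verts G"
    and red: "reducible d G (merge p u v w)"
    and deg: "\<And>x. x \<in> p ` verts G \<Longrightarrow> red_degree (quotient_trigraph G p) x \<le> d"
  shows "reducible d G p"
proof -
  let ?q = "merge p u v w"
  let ?m = "card (?q ` verts G)"
  have c: "card (p ` verts G) = Suc ?m" and ne: "?q ` verts G \<noteq> {}"
    using card_image_merge[OF assms(1-5)] by auto
  then have m: "1 \<le> ?m" using assms(1) by (simp add: Suc_le_eq card_gt_0_iff)
  obtain S where S: "S ?m = quotient_trigraph G ?q"
     "\<exists>x. S 1 = \<lparr>tverts = {x}, black = {}, red = {}\<rparr>"
     "\<forall>s\<in>{1..<?m}. contraction (S (s + 1)) (S s)"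
     "\<forall>s\<in>{1..?m}. \<forall>v\<in>tverts (S s). red_degree (S s) v \<le> d"
    using red unfolding reducible_def by blast
  have "contraction (quotient_trigraph G p) (quotient_trigraph G ?q)"
    unfolding contraction_def tverts_quotient
    using contract_quotient[OF assms(2-5), symmetric] assms(2-5) by blast
  then show ?thesis
    unfolding reducible_def c using S m deg
    \<comment> \<open>Sequences are indexed by the number of parts, so a new first trigraph is
      inserted at the next larger index.\<close>
    by (intro exI[of _ "S(Suc ?m := quotient_trigraph G p)"]) (auto simp: less_Suc_eq le_Suc_eq)
qed

lemma fresh_label:
  assumes "finite (A :: 'a::infinite set)"
  obtains w where "w \<notin> A"
  using ex_new_if_finite[OF infinite_UNIV assms] by blast

text \<open>A red degree cannot exceed the number of parts, so any order of contractions works from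
  here on. This finishes every sequence and also gives the trivial bound by the order of
  \<open>G\<close>.\<close>

lemma reducible_if_few_parts:
  fixes G :: "'a::infinite graph"
  assumes "finite (verts G)" "verts G \<noteq> {}" "card (p ` verts G) \<le> d"
  shows "reducible d G p"
  using assms(3)
proof (induction "card (p ` verts G)" arbitrary: p rule: less_induct)
  case less
  have fin: "finite (p ` verts G)" using assms(1) by simp
  show ?case
  proof (cases "card (p ` verts G) = 1")
    case True
    then show ?thesis by (rule reducible_singleton)
  next
    case False
    moreover have "card (p ` verts G) \<noteq> 0" using assms by simp
    ultimately obtain u v where uv: "u \<in> p ` verts G" "v \<in> p ` verts G" "u \<noteq> v"
      using card_le_Suc0_iff_eq[OF fin] by force
    obtain w where w: "w \<notin> p ` verts G" using fresh_label[OF fin] .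
    have c: "card (p ` verts G) = Suc (card (merge p u v w ` verts G))"
      by (rule card_image_merge[OF assms(1) uv w])
    have "red_degree (quotient_trigraph G p) x \<le> d" for x
    proof -
      have "red_degree (quotient_trigraph G p) x \<le> card (p ` verts G)"
        unfolding red_degree_quotient by (rule card_mono[OF fin]) auto
      with less.prems show ?thesis by simp
    qed
    then show ?thesis
      using reducible_merge[OF assms(1) uv w less.hyps] c less.prems by simp
  qed
qed

lemma tww_le:
  fixes G :: "'a::infinite graph"
  assumes "is_graph G" "reducible d G (\<lambda>x. x)"
  shows "tww G \<le> d"
proof -
  have "\<exists>S. is_d_sequence d G S"
    using assms(2) unfolding reducible_def is_d_sequence_def contraction_sequence_def
      trigraph_of_eq_quotient[OF assms(1)] by simp
  then show ?thesis unfolding tww_def by (rule Least_le)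
qed

lemma tww_le_card:
  fixes G :: "'a::infinite graph"
  assumes "is_graph G"
  shows "tww G \<le> card (verts G)"
  using assms by (intro tww_le[OF assms] reducible_if_few_parts) (simp_all add: is_graph_def)

text \<open>\<open>LEAST\<close> yields a witness only if some \<open>d\<close> works; the order of
  the graph does.\<close>

lemma tww_sequence:
  fixes G :: "'a::infinite graph"
  assumes "is_graph G"
  obtains S where "is_d_sequence (tww G) G S"
proof -
  have "reducible (card (verts G)) G (\<lambda>x. x)"
    using assms by (intro reducible_if_few_parts) (auto simp: is_graph_def)
  then have "\<exists>S. is_d_sequence (card (verts G)) G S"
    unfolding reducible_def is_d_sequence_def contraction_sequence_def
      trigraph_of_eq_quotient[OF assms(1)] by simp
  then have "\<exists>S. is_d_sequence (tww G) G S"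
    unfolding tww_def by (rule LeastI)
  then show ?thesis using that by blast
qed

section \<open>Merging the classes of a partition one vertex at a time\<close>

definition splitters :: "'a graph \<Rightarrow> 'a set \<Rightarrow> 'a set" where
  "splitters G F = {z \<in> verts G. \<exists>x\<in>F. \<exists>y\<in>F. adj G x z \<noteq> adj G y z}"

definition nontrivial :: "('a \<Rightarrow> 'b) \<Rightarrow> 'a set \<Rightarrow> 'a \<Rightarrow> bool" where
  "nontrivial p A x \<longleftrightarrow> x \<in> A \<and> (\<exists>x'\<in>A. x' \<noteq> x \<and> p x' = p x)"

text \<open>While the classes of \<open>f\<close> are contracted one vertex at a time, a red neighbour of a part is
  either a singleton that splits the part, or one of the non-singleton parts, of which each
  class of \<open>f\<close> contains at most one.\<close>

lemma red_degree_le_of_refinement: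
  fixes p :: "'a \<Rightarrow> 'a" and f :: "'a \<Rightarrow> 'b"
  assumes fin: "finite (verts G)"
    and refines: "\<And>x y. x \<in> verts G \<Longrightarrow> y \<in> verts G \<Longrightarrow> p x = p y \<Longrightarrow> f x = f y"
    and unique: "\<And>x y. nontrivial p (verts G) x \<Longrightarrow> nontrivial p (verts G) y \<Longrightarrow> f x = f y \<Longrightarrow> p x = p y"
    and split: "\<And>c. card (splitters G {x \<in> verts G. f x = c}) \<le> k"
    and P: "P \<in> p ` verts G"
  shows "red_degree (quotient_trigraph G p) P \<le> card (f ` verts G) + k"
proof -
  let ?V = "verts G"
  obtain a where a: "a \<in> ?V" "P = p a" using P by auto
  let ?N = "{y \<in> p ` ?V. {P, y} \<in> red (quotient_trigraph G p)}"
  let ?M = "p ` {x. nontrivial p ?V x}"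
  let ?S = "splitters G {x \<in> ?V. f x = f a}"
  have finS: "finite ?S" using fin unfolding splitters_def by simp
  have fM: "finite {x. nontrivial p ?V x}"
    by (rule finite_subset[OF _ fin]) (auto simp: nontrivial_def)
  have "y \<in> ?M \<union> p ` ?S" if y: "y \<in> ?N" for y
  proof (cases "y \<in> ?M")
    case False
    from y obtain z where z: "z \<in> ?V" "y = p z" by auto
    have single: "x = z" if "x \<in> ?V" "p x = y" for x
      using False z that unfolding nontrivial_def by blast
    from y have "\<not> complete_between G p P y" "\<not> empty_between G p P y"
      by (auto simp: red_quotient_iff)
    then obtain b c where "b \<in> ?V" "p b = P" "\<not> adj G b z" "c \<in> ?V" "p c = P" "adj G c z"
      using single unfolding complete_between_def empty_between_def by metis
    moreover then have "f b = f a" "f c = f a" using refines a by metis+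
    ultimately have "z \<in> ?S" using z unfolding splitters_def by blast
    then show ?thesis using z by blast
  qed simp
  then have "?N \<subseteq> ?M \<union> p ` ?S" by blast
  then have "card ?N \<le> card (?M \<union> p ` ?S)"
    using fM finS by (intro card_mono) auto
  also have "\<dots> \<le> card ?M + card (p ` ?S)" by (rule card_Un_le)
  also have "card (p ` ?S) \<le> k" using card_image_le[OF finS, of p] split[of "f a"] by linarith
  also have "card ?M \<le> card (f ` ?V)"
  proof -
    \<comment> \<open>By \<open>unique\<close>, a non-singleton part is determined by the class of
      \<open>f\<close> that contains it, so there are at most as many such parts as classes.\<close>
    define h where "h c = p (SOME x. nontrivial p ?V x \<and> f x = c)" for c
    have "p x = h (f x)" if "nontrivial p ?V x" for x
    proof -
      let ?r = "SOME x'. nontrivial p ?V x' \<and> f x' = f x"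
      have "nontrivial p ?V ?r \<and> f ?r = f x"
        by (rule someI[where x=x]) (use that in auto)
      with unique[of x ?r] that show ?thesis unfolding h_def by simp
    qed
    then have "?M \<subseteq> h ` f ` ?V" by (auto simp: nontrivial_def)
    then have "card ?M \<le> card (h ` f ` ?V)" using fin by (intro card_mono) auto
    also have "\<dots> \<le> card (f ` ?V)" using fin by (intro card_image_le) auto
    finally show ?thesis .
  qed
  finally show ?thesis by (simp add: red_degree_quotient)
qed

text \<open>The invariant is that \<open>p\<close> refines \<open>f\<close> and that each class of
  \<open>f\<close> holds at most one non-singleton part. A contraction inside a class can always be
  chosen to preserve it, and it bounds the red degree. When no such contraction is left, the parts
  are no more numerous than the classes and the order is irrelevant.\<close>

lemma reducible_of_refinement:
  fixes G :: "'a::infinite graph" and f :: "'a \<Rightarrow> 'b"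
  assumes fin: "finite (verts G)" "verts G \<noteq> {}"
    and split: "\<And>c. card (splitters G {x \<in> verts G. f x = c}) \<le> k"
    and "\<And>x y. x \<in> verts G \<Longrightarrow> y \<in> verts G \<Longrightarrow> p x = p y \<Longrightarrow> f x = f y"
    and "\<And>x y. nontrivial p (verts G) x \<Longrightarrow> nontrivial p (verts G) y \<Longrightarrow> f x = f y \<Longrightarrow> p x = p y"
  shows "reducible (card (f ` verts G) + k) G p"
  using assms(4,5)
proof (induction "card (p ` verts G)" arbitrary: p rule: less_induct)
  case less
  let ?V = "verts G"
  note refines = less.prems(1) and unique = less.prems(2)
  show ?case
  proof (cases "\<forall>x\<in>?V. \<forall>y\<in>?V. f x = f y \<longrightarrow> p x = p y")
    case True
    define h where "h c = p (SOME x. x \<in> ?V \<and> f x = c)" for c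
    have "p x = h (f x)" if "x \<in> ?V" for x
    proof -
      let ?r = "SOME x'. x' \<in> ?V \<and> f x' = f x"
      have r: "?r \<in> ?V \<and> f ?r = f x"
        by (rule someI[where x=x]) (use that in auto)
      have "f x = f ?r \<longrightarrow> p x = p ?r"
        using True that r by blast
      with r show ?thesis unfolding h_def by simp
    qed
    then have "p ` ?V = h ` f ` ?V" by (simp add: image_image)
    moreover have "card (h ` f ` ?V) \<le> card (f ` ?V)" using fin by (intro card_image_le) simp
    ultimately have "card (p ` ?V) \<le> card (f ` ?V)" by simp
    then show ?thesis using fin by (intro reducible_if_few_parts) auto
  next
    case False
    \<comment> \<open>If the class already has a non-singleton part, \<open>x\<close> is taken from
      it, so that this part grows and no second one arises; otherwise any two parts of the class
      will do.\<close>
    have "\<exists>x y. x \<in> ?V \<and> y \<in> ?V \<and> f x = f y \<and> p x \<noteq> p y \<and>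
        (\<forall>z. nontrivial p ?V z \<and> f z = f x \<longrightarrow> p z = p x)"
    proof -
      obtain x y where xy: "x \<in> ?V" "y \<in> ?V" "f x = f y" "p x \<noteq> p y" using False by blast
      show ?thesis
      proof (cases "\<exists>z. nontrivial p ?V z \<and> f z = f x")
        case True
        then obtain z where z: "nontrivial p ?V z" "f z = f x" by blast
        then have "z \<in> ?V" by (simp add: nontrivial_def)
        have "\<forall>z'. nontrivial p ?V z' \<and> f z' = f z \<longrightarrow> p z' = p z"
          using unique z by blast
        moreover obtain y' where "y' \<in> ?V" "f z = f y'" "p z \<noteq> p y'"
          using xy z(2) by (cases "p z = p x") auto
        ultimately show ?thesis using \<open>z \<in> ?V\<close> by blast
      next
        case False
        then show ?thesis using xy by blast
      qed
    qed
    then obtain x y where xy: "x \<in> ?V" "y \<in> ?V" "f x = f y" "p x \<noteq> p y"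
      and nt: "\<And>z. nontrivial p ?V z \<Longrightarrow> f z = f x \<Longrightarrow> p z = p x" by blast
    obtain w where w: "w \<notin> p ` ?V" using fresh_label[of "p ` ?V"] fin by blast
    let ?q = "merge p (p x) (p y) w"
    have w': "p z \<noteq> w" if "z \<in> ?V" for z using w that by auto
    have uv: "p x \<in> p ` ?V" "p y \<in> p ` ?V" using xy by auto
    have c: "card (p ` ?V) = Suc (card (?q ` ?V))"
      by (rule card_image_merge[OF fin(1) uv xy(4) w])
    have fw: "f c = f x" if "c \<in> ?V" "?q c = w" for c
    proof -
      have "p c = p x \<or> p c = p y"
        using that w' by (auto simp: merge_def split: if_splits)
      then show ?thesis using refines[of c x] refines[of c y] that xy by auto
    qed
    have qw: "?q c = p c" if "?q c \<noteq> w" for c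
      using that by (auto simp: merge_def split: if_splits)
    have refines': "f a = f b" if ab: "a \<in> ?V" "b \<in> ?V" "?q a = ?q b" for a b
    proof (cases "?q a = w")
      case True
      then show ?thesis using ab fw by simp
    next
      case False
      then show ?thesis using ab qw[of a] qw[of b] refines[of a b] by simp
    qed
    have unique': "?q a = ?q b"
      if ab: "nontrivial ?q ?V a" "nontrivial ?q ?V b" "f a = f b" for a b
    proof -
      \<comment> \<open>A vertex in a non-singleton part after the merge either was in one before
        and keeps its label, or belongs to the new part \<open>w\<close>.\<close>
      have *: "nontrivial p ?V c \<and> ?q c = p c \<or> ?q c = w \<and> f c = f x"
        if c: "nontrivial ?q ?V c" for c
      proof (cases "?q c = w")
        case True
        then show ?thesis using c fw by (simp add: nontrivial_def)
      next
        case False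
        obtain c' where c': "c' \<in> ?V" "c' \<noteq> c" "?q c' = ?q c" "c \<in> ?V"
          using c by (auto simp: nontrivial_def)
        then have "p c' = p c" using False qw[of c] qw[of c'] by simp
        then show ?thesis using c' False qw[of c] by (auto simp: nontrivial_def)
      qed
      consider "nontrivial p ?V a" "?q a = p a" "nontrivial p ?V b" "?q b = p b"
        | "nontrivial p ?V a" "f a = f x" "?q b = w"
        | "nontrivial p ?V b" "f b = f x" "?q a = w"
        | "?q a = w" "?q b = w"
        using *[OF ab(1)] *[OF ab(2)] ab(3) by auto
      then show ?thesis
      proof cases
        case 1 then show ?thesis using unique[of a b] ab(3) by simp
      next
        case 2 then show ?thesis using nt[of a] by (simp add: merge_def)
      next
        case 3 then show ?thesis using nt[of b] by (simp add: merge_def)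
      qed simp
    qed
    have "card (?q ` ?V) < card (p ` ?V)" using c by simp
    then have "reducible (card (f ` ?V) + k) G ?q"
      by (rule less.hyps[OF _ refines' unique'])
    moreover have "red_degree (quotient_trigraph G p) P \<le> card (f ` ?V) + k" if "P \<in> p ` ?V" for P
      using refines unique split that
      by (intro red_degree_le_of_refinement[OF fin(1), of p f]) blast+
    ultimately show ?thesis
      by (rule reducible_merge[OF fin(1) uv xy(4) w])
  qed
qed

text \<open>The identity labelling has only singleton parts, so the invariant of the contraction
  process holds at the start.\<close>

lemma tww_le_partition:
  fixes G :: "'a::infinite graph" and f :: "'a \<Rightarrow> 'b"
  assumes "is_graph G" "\<And>c. card (splitters G {x \<in> verts G. f x = c}) \<le> k"
  shows "tww G \<le> card (f ` verts G) + k"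
proof -
  have "finite (verts G)" "verts G \<noteq> {}" using assms(1) by (auto simp: is_graph_def)
  then have "reducible (card (f ` verts G) + k) G (\<lambda>x. x)"
    by (rule reducible_of_refinement) (use assms(2) in \<open>auto simp: nontrivial_def\<close>)
  then show ?thesis by (rule tww_le[OF assms(1)])
qed

subsection \<open>Packing in graphs of bounded VC-dimension\<close>

text \<open>Pajor's form of the Sauer-Shelah lemma. Removing \<open>x\<close> splits
  \<open>F\<close> into traces \<open>?A\<close> and \<open>?B\<close>, with card F = card (?A Un
  ?B) + card (?A Int ?B). What the union shatters is shattered by \<open>F\<close>; what the
  intersection shatters stays shattered by \<open>F\<close> after \<open>x\<close> is added, since
  each trace there extends both with and without \<open>x\<close>.\<close>

lemma card_le_card_shattered:
  assumes "finite T" "F \<subseteq> Pow T"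
  shows "card F \<le> card {S. S \<subseteq> T \<and> shattered F S}"
  using assms
proof (induction T arbitrary: F rule: finite_induct)
  case empty
  show ?case
  proof (cases "F = {}")
    case False
    with empty have "F = {{}}" by auto
    moreover from this have "{S. S \<subseteq> {} \<and> shattered F S} = {{}}" by (auto simp: shattered_def)
    ultimately show ?thesis by simp
  qed simp
next
  case (insert x T)
  let ?A = "{A \<in> F. x \<notin> A}" and ?B = "{A. x \<notin> A \<and> insert x A \<in> F}"
  let ?sh = "\<lambda>F T. {S. S \<subseteq> T \<and> shattered F S}"
  have sub: "?A \<subseteq> Pow T" "?B \<subseteq> Pow T" using insert.prems by auto
  then have fin: "finite ?A" "finite ?B" using insert.hyps(1) by (auto intro: finite_subset)
  have F: "F = ?A \<union> insert x ` ?B"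
  proof
    show "F \<subseteq> ?A \<union> insert x ` ?B"
    proof
      fix A assume "A \<in> F"
      show "A \<in> ?A \<union> insert x ` ?B"
      proof (cases "x \<in> A")
        case True
        then have "insert x (A - {x}) = A" by auto
        with \<open>A \<in> F\<close> have "A - {x} \<in> ?B" by auto
        with \<open>insert x (A - {x}) = A\<close> show ?thesis by blast
      qed (use \<open>A \<in> F\<close> in auto)
    qed
  qed auto
  have "inj_on (insert x) ?B" by (auto simp: inj_on_def)
  then have "card (insert x ` ?B) = card ?B" by (rule card_image)
  moreover have "card (?A \<union> insert x ` ?B) = card ?A + card (insert x ` ?B)"
    using fin by (intro card_Un_disjoint) auto
  ultimately have "card F = card ?A + card ?B" using F by simp
  also have "\<dots> = card (?A \<union> ?B) + card (?A \<inter> ?B)"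
    using fin by (rule card_Un_Int)
  also have "\<dots> \<le> card (?sh (?A \<union> ?B) T) + card (?sh (?A \<inter> ?B) T)"
    using sub by (intro add_mono insert.IH) auto
  also have "card (?sh (?A \<inter> ?B) T) = card (insert x ` ?sh (?A \<inter> ?B) T)"
    using insert.hyps(2) by (intro card_image[symmetric]) (auto simp: inj_on_def insert_eq_iff)
  also have "card (?sh (?A \<union> ?B) T) + \<dots> = card (?sh (?A \<union> ?B) T \<union> insert x ` ?sh (?A \<inter> ?B) T)"
    using insert.hyps by (intro card_Un_disjoint[symmetric]) auto
  also have "\<dots> \<le> card (?sh F (insert x T))"
  proof (rule card_mono)
    show "finite (?sh F (insert x T))" using insert.hyps(1) by simp
    have "shattered F S" if S: "S \<subseteq> T" "shattered (?A \<union> ?B) S" for S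
      unfolding shattered_def
    proof (intro allI impI)
      fix A assume "A \<subseteq> S"
      then obtain B where B: "B \<in> ?A \<union> ?B" "B \<inter> S = A" using S unfolding shattered_def by blast
      moreover have "insert x B \<inter> S = A" using B S insert.hyps(2) by auto
      ultimately show "\<exists>B\<in>F. B \<inter> S = A" by blast
    qed
    moreover have "shattered F (insert x S)" if S: "S \<subseteq> T" "shattered (?A \<inter> ?B) S" for S
      unfolding shattered_def
    proof (intro allI impI)
      fix A assume A: "A \<subseteq> insert x S"
      then have "A - {x} \<subseteq> S" by auto
      then have "\<exists>B\<in>?A \<inter> ?B. B \<inter> S = A - {x}"
        using S(2)[unfolded shattered_def, rule_format, of "A - {x}"] by blast
      then obtain B where B: "B \<in> ?A \<inter> ?B" "B \<inter> S = A - {x}" by blast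
      show "\<exists>B\<in>F. B \<inter> insert x S = A"
      proof (cases "x \<in> A")
        case True
        then have "insert x B \<inter> insert x S = A" using B by auto
        then show ?thesis using B by blast
      next
        case False
        then have "B \<inter> insert x S = A" using B by auto
        then show ?thesis using B by blast
      qed
    qed
    ultimately show "?sh (?A \<union> ?B) T \<union> insert x ` ?sh (?A \<inter> ?B) T \<subseteq> ?sh F (insert x T)"
      by auto
  qed
  finally show ?case .
qed

lemma card_small_subsets:
  assumes "finite T"
  shows "card {S. S \<subseteq> T \<and> card S \<le> k} \<le> (card T + 1) ^ k"
proof (induction k)
  case 0
  have "{S. S \<subseteq> T \<and> card S \<le> 0} = {{}}" using assms by (auto dest: finite_subset)
  then show ?case by simp
next
  case (Suc k)
  let ?N = "\<lambda>k. {S. S \<subseteq> T \<and> card S \<le> k}"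
  have fin: "finite (?N k)" using assms by simp
  have "S \<in> ?N k \<union> (\<lambda>(x, S). insert x S) ` (T \<times> ?N k)" if S: "S \<in> ?N (Suc k)" for S
  proof (cases "S = {}")
    case False
    then obtain x where x: "x \<in> S" by blast
    have "finite S" using S assms finite_subset by auto
    then have "S - {x} \<in> ?N k" using S x by auto
    moreover have "S = insert x (S - {x})" "x \<in> T" using x S by auto
    ultimately show ?thesis by blast
  qed auto
  then have "card (?N (Suc k)) \<le> card (?N k \<union> (\<lambda>(x, S). insert x S) ` (T \<times> ?N k))"
    using assms fin by (intro card_mono) auto
  also have "\<dots> \<le> card (?N k) + card ((\<lambda>(x, S). insert x S) ` (T \<times> ?N k))" by (rule card_Un_le)
  also have "card ((\<lambda>(x, S). insert x S) ` (T \<times> ?N k)) \<le> card T * card (?N k)"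
    using card_image_le[of "T \<times> ?N k"] assms fin by (simp add: card_cartesian_product)
  also have "card (?N k) + card T * card (?N k) \<le> (card T + 1) ^ Suc k"
    using mult_le_mono2[OF Suc.IH, of "card T + 1"] by simp
  finally show ?case by simp
qed

lemma sauer_shelah:
  assumes "finite T" "F \<subseteq> Pow T" "\<And>S. S \<subseteq> T \<Longrightarrow> shattered F S \<Longrightarrow> card S \<le> k"
  shows "card F \<le> (card T + 1) ^ k"
proof -
  have "card {S. S \<subseteq> T \<and> shattered F S} \<le> card {S. S \<subseteq> T \<and> card S \<le> k}"
    using assms by (intro card_mono) auto
  then show ?thesis
    using card_le_card_shattered[OF assms(1,2)] card_small_subsets[OF assms(1), of k] by linarith
qed

text \<open>Greedy choice: by double counting, some point of \<open>V\<close> lies in at least a fraction \<open>\<delta>\<close> of the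
  sets not hit so far.\<close>

lemma greedy_hitting_set:
  fixes D :: "'b \<Rightarrow> 'a set" and \<delta> :: real
  assumes V: "finite V" "V \<noteq> {}" and Q: "finite Q" and \<delta>: "0 \<le> \<delta>" "\<delta> \<le> 1"
    and D: "\<And>q. q \<in> Q \<Longrightarrow> D q \<subseteq> V" "\<And>q. q \<in> Q \<Longrightarrow> \<delta> * card V \<le> card (D q)"
  shows "\<exists>T. T \<subseteq> V \<and> card T \<le> s \<and> card {q \<in> Q. D q \<inter> T = {}} \<le> (1 - \<delta>) ^ s * card Q"
proof (induction s)
  case 0
  show ?case by (intro exI[of _ "{}"]) simp
next
  case (Suc s)
  then obtain T where T: "T \<subseteq> V" "card T \<le> s"
    "card {q \<in> Q. D q \<inter> T = {}} \<le> (1 - \<delta>) ^ s * card Q" by blast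
  let ?R = "{q \<in> Q. D q \<inter> T = {}}"
  have finR: "finite ?R" using Q by simp
  have "\<exists>x\<in>V. \<delta> * card ?R \<le> card {q \<in> ?R. x \<in> D q}"
  proof (rule ccontr)
    assume "\<not> ?thesis"
    then have "(\<Sum>x\<in>V. real (card {q \<in> ?R. x \<in> D q})) < (\<Sum>x\<in>V. \<delta> * card ?R)"
      using V by (intro sum_strict_mono) auto
    also have "\<dots> = (\<Sum>q\<in>?R. \<delta> * card V)" by simp
    also have "\<dots> \<le> (\<Sum>q\<in>?R. real (card (D q)))" using D by (intro sum_mono) auto
    also have "\<dots> = real (\<Sum>q\<in>?R. card {x \<in> V. x \<in> D q})"
    proof -
      have "{x \<in> V. x \<in> D q} = D q" if "q \<in> ?R" for q using D that by auto
      then show ?thesis by simp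
    qed
    also have "(\<Sum>q\<in>?R. card {x \<in> V. x \<in> D q}) = (\<Sum>x\<in>V. card {q \<in> ?R. x \<in> D q})"
      using sum.swap_restrict[OF finR V(1), of "\<lambda>_ _. 1::nat" "\<lambda>q x. x \<in> D q"] by simp
    finally show False by simp
  qed
  then obtain x where x: "x \<in> V" "\<delta> * card ?R \<le> card {q \<in> ?R. x \<in> D q}" by blast
  have "{q \<in> Q. D q \<inter> insert x T = {}} = ?R - {q \<in> ?R. x \<in> D q}" by auto
  moreover have "card {q \<in> ?R. x \<in> D q} \<le> card ?R" using finR by (intro card_mono) auto
  moreover have "card (?R - {q \<in> ?R. x \<in> D q}) = card ?R - card {q \<in> ?R. x \<in> D q}"
    by (rule card_Diff_subset) (rule rev_finite_subset[OF finR], auto)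
  ultimately have "real (card {q \<in> Q. D q \<inter> insert x T = {}}) = card ?R - real (card {q \<in> ?R. x \<in> D q})"
    by (simp only: of_nat_diff)
  also have "\<dots> \<le> (1 - \<delta>) * card ?R" using x by (simp add: algebra_simps)
  also have "\<dots> \<le> (1 - \<delta>) * ((1 - \<delta>) ^ s * card Q)"
    using T(3) \<delta> by (intro mult_left_mono) auto
  finally have "card {q \<in> Q. D q \<inter> insert x T = {}} \<le> (1 - \<delta>) ^ Suc s * card Q"
    by (simp add: mult.assoc)
  moreover have "card (insert x T) \<le> Suc s"
    using T(2) card_insert_le_m1[of "Suc s" T x] by simp
  ultimately show ?case using T(1) x(1) by blast
qed

section \<open>Packing of neighbourhoods that are pairwise far apart\<close>

definition separators :: "'a graph \<Rightarrow> 'a \<Rightarrow> 'a \<Rightarrow> 'a set" where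
  "separators G u v = {x \<in> verts G. adj G u x \<noteq> adj G v x}"

lemma card_le_vcdim:
  assumes "is_graph G" "S \<subseteq> verts G" "shattered (neighbourhood G ` verts G) S"
  shows "card S \<le> vcdim G"
  unfolding vcdim_def vc_dimension_def
  using assms by (intro Max_ge) (auto simp: is_graph_def)

text \<open>Fewer than one pair of distinct elements of \<open>Z\<close> remains unhit by a greedy
  sample \<open>T\<close> of at most \<open>s\<close> vertices, hence none does. Neighbourhoods of
  elements of \<open>Z\<close> then have distinct traces on \<open>T\<close>, and Sauer-Shelah
  counts these traces.\<close>

lemma separated_set_bound:
  fixes \<delta> :: real
  assumes G: "is_graph G" and Z: "Z \<subseteq> verts G" and \<delta>: "0 < \<delta>" "\<delta> < 1"
    and sep: "\<And>u v. u \<in> Z \<Longrightarrow> v \<in> Z \<Longrightarrow> u \<noteq> v \<Longrightarrow> \<delta> * card (verts G) \<le> card (separators G u v)"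
    and s: "(1 - \<delta>) ^ s * (card Z)\<^sup>2 < 1"
  shows "card Z \<le> (s + 1) ^ vcdim G"
proof -
  let ?V = "verts G"
  have V: "finite ?V" "?V \<noteq> {}" using G by (auto simp: is_graph_def)
  have finZ: "finite Z" using Z V(1) by (rule finite_subset)
  let ?Q = "{(u, v). u \<in> Z \<and> v \<in> Z \<and> u \<noteq> v}"
  have Q: "?Q \<subseteq> Z \<times> Z" by auto
  then have finQ: "finite ?Q" using finZ by (auto intro: finite_subset)
  have "card ?Q \<le> card (Z \<times> Z)" using Q finZ by (intro card_mono) auto
  then have cQ: "real (card ?Q) \<le> (card Z)\<^sup>2"
    by (simp add: card_cartesian_product power2_eq_square flip: of_nat_mult)
  obtain T where T: "T \<subseteq> ?V" "card T \<le> s"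
    "card {q \<in> ?Q. (case q of (u, v) \<Rightarrow> separators G u v) \<inter> T = {}} \<le> (1 - \<delta>) ^ s * card ?Q"
    using greedy_hitting_set[OF V finQ, of \<delta> "\<lambda>(u, v). separators G u v" s] \<delta> sep
    by (auto simp: separators_def)
  have finT: "finite T" using T(1) V(1) by (rule finite_subset)
  note T(3)
  also have "(1 - \<delta>) ^ s * card ?Q \<le> (1 - \<delta>) ^ s * (card Z)\<^sup>2"
    using cQ \<delta> by (intro mult_left_mono) auto
  also note s
  finally have "card {q \<in> ?Q. (case q of (u, v) \<Rightarrow> separators G u v) \<inter> T = {}} = 0" by linarith
  then have hit: "separators G u v \<inter> T \<noteq> {}" if "u \<in> Z" "v \<in> Z" "u \<noteq> v" for u v
    using finQ that by auto
  let ?F = "(\<lambda>z. neighbourhood G z \<inter> T) ` Z"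
  have "inj_on (\<lambda>z. neighbourhood G z \<inter> T) Z"
  proof (rule inj_onI, rule ccontr)
    fix u v assume uv: "u \<in> Z" "v \<in> Z" "neighbourhood G u \<inter> T = neighbourhood G v \<inter> T" "u \<noteq> v"
    with hit obtain x where "x \<in> separators G u v" "x \<in> T" by blast
    with uv(3) show False by (auto simp: separators_def neighbourhood_def)
  qed
  then have "card Z = card ?F" by (simp add: card_image)
  also have "\<dots> \<le> (card T + 1) ^ vcdim G"
  proof (rule sauer_shelah[OF finT])
    fix S assume S: "S \<subseteq> T" "shattered ?F S"
    have "shattered (neighbourhood G ` ?V) S"
      unfolding shattered_def
    proof (intro allI impI)
      fix A assume "A \<subseteq> S"
      then obtain z where "z \<in> Z" "neighbourhood G z \<inter> T \<inter> S = A" using S(2) unfolding shattered_def by blast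
      moreover then have "neighbourhood G z \<inter> S = A" using S(1) by blast
      ultimately show "\<exists>B\<in>neighbourhood G ` ?V. B \<inter> S = A" using Z by blast
    qed
    then show "card S \<le> vcdim G" using card_le_vcdim[OF G] S(1) T(1) by blast
  qed auto
  also have "\<dots> \<le> (s + 1) ^ vcdim G" using T(2) by (intro power_mono) auto
  finally show ?thesis .
qed

text \<open>The squared term is the square of the size of a set just too large for
  \<open>separated_set_bound\<close>: such a set has one element more than the bound
  \<open>(s + 1) ^ k\<close> allows.\<close>

lemma exponential_beats_polynomial:
  fixes \<delta> :: real
  assumes "0 < \<delta>" "\<delta> < 1"
  obtains s where "(1 - \<delta>) ^ s * (((real s + 1) ^ k + 1)\<^sup>2) < 1"
proof -
  \<comment> \<open>The factor 4 comes from (x + 1)^2 \<le> (2 x)^2 for 1 \<le> x, the power of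
    \<delta> from rescaling s + 1 to \<delta> (s + 1), and the exponential from replacing s by s + 1
    in the exponent.\<close>
  define c where "c = \<delta> ^ (2 * k) * exp (- \<delta>) / 4"
  have c: "c > 0" using assms by (simp add: c_def)
  have "filterlim (\<lambda>s. 1 + real s) at_top sequentially"
    using filterlim_compose[OF filterlim_real_sequentially filterlim_Suc] by simp
  then have "filterlim (\<lambda>s. \<delta> * (real s + 1)) at_top sequentially"
    by (intro filterlim_tendsto_pos_mult_at_top[OF tendsto_const assms(1)]) (simp add: add.commute)
  from filterlim_compose[OF tendsto_power_div_exp_0 this]
  have "\<forall>\<^sub>F s in sequentially. (\<delta> * (real s + 1)) ^ (2 * k) / exp (\<delta> * (real s + 1)) < c"
    using c by (rule order_tendstoD)
  then obtain s where s: "(\<delta> * (real s + 1)) ^ (2 * k) / exp (\<delta> * (real s + 1)) < c"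
    using eventually_happens'[OF sequentially_bot] by blast
  have "(1 - \<delta>) ^ s \<le> exp (- \<delta>) ^ s"
    using assms exp_ge_add_one_self[of "- \<delta>"] by (intro power_mono) auto
  also have "\<dots> = exp (- \<delta> * s)" by (simp add: exp_of_nat_mult[symmetric] mult.commute)
  finally have 1: "(1 - \<delta>) ^ s \<le> exp (- \<delta> * s)" .
  have "((real s + 1) ^ k + 1)\<^sup>2 \<le> (2 * (real s + 1) ^ k)\<^sup>2"
    by (intro power_mono) auto
  also have "\<dots> = 4 * (real s + 1) ^ (2 * k)"
    by (simp add: power_mult_distrib power_even_eq)
  finally have "(1 - \<delta>) ^ s * (((real s + 1) ^ k + 1)\<^sup>2) \<le> exp (- \<delta> * s) * (4 * (real s + 1) ^ (2 * k))"
    using 1 assms by (intro mult_mono) auto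
  also have "\<dots> = (\<delta> * (real s + 1)) ^ (2 * k) / exp (\<delta> * (real s + 1)) / c"
  proof -
    define y where "y = real s + 1"
    have "exp (- \<delta> * s) = exp \<delta> / exp (\<delta> * y)"
      by (simp add: y_def exp_diff[symmetric] algebra_simps)
    then show ?thesis
      using assms unfolding c_def y_def[symmetric]
      by (simp add: power_mult_distrib exp_minus field_simps)
  qed
  also have "\<dots> < 1" using s c by (simp only: divide_less_eq_1_pos)
  finally show ?thesis by (rule that)
qed

subsection \<open>Clusters and sublinear twin-width\<close>

definition separated :: "'a graph \<Rightarrow> real \<Rightarrow> 'a set \<Rightarrow> bool" where
  "separated G r Z \<longleftrightarrow> (\<forall>u\<in>Z. \<forall>v\<in>Z. u \<noteq> v \<longrightarrow> r \<le> card (separators G u v))"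

text \<open>The point is uniformity: \<open>K\<close> depends on \<delta> and \<open>k\<close> only
  and serves graphs of every order.\<close>

lemma packing_bound:
  fixes \<delta> :: real
  assumes \<delta>: "0 < \<delta>" "\<delta> < 1"
  obtains K where "\<And>(G :: 'a graph) Z. is_graph G \<Longrightarrow> vcdim G \<le> k \<Longrightarrow> Z \<subseteq> verts G \<Longrightarrow>
    separated G (\<delta> * card (verts G)) Z \<Longrightarrow> card Z \<le> K"
proof -
  obtain s where s: "(1 - \<delta>) ^ s * (((real s + 1) ^ k + 1)\<^sup>2) < 1"
    using exponential_beats_polynomial[OF \<delta>] .
  show ?thesis
  proof (rule that, rule ccontr)
    fix G :: "'a graph" and Z
    assume G: "is_graph G" "vcdim G \<le> k" and Z: "Z \<subseteq> verts G"
      "separated G (\<delta> * card (verts G)) Z" "\<not> card Z \<le> (s + 1) ^ k"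
    then have "(s + 1) ^ k + 1 \<le> card Z" by simp
    \<comment> \<open>The choice of \<open>s\<close> tolerates sets of exactly this size, so a
      larger \<open>Z\<close> is cut down; separation passes to subsets.\<close>
    then obtain Z' where Z': "Z' \<subseteq> Z" "card Z' = (s + 1) ^ k + 1"
      by (rule obtain_subset_with_card_n)
    have "card Z' \<le> (s + 1) ^ vcdim G"
    proof (rule separated_set_bound[OF G(1) _ \<delta>])
      show "(1 - \<delta>) ^ s * (card Z')\<^sup>2 < 1" using s Z'(2) by (simp add: add.commute)
    qed (use Z Z'(1) in \<open>auto simp: separated_def\<close>)
    also have "\<dots> \<le> (s + 1) ^ k" using G(2) by (intro power_increasing) auto
    finally show False using Z'(2) by simp
  qed
qed

lemma chunk_partition:
  fixes c :: "'a \<Rightarrow> 'b"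
  assumes "finite V" "0 < p"
  obtains f :: "'a \<Rightarrow> 'b \<times> nat" where "card (f ` V) \<le> card V div p + card (c ` V)"
    "\<And>x. fst (f x) = c x" "\<And>j. card {x \<in> V. f x = j} \<le> p"
proof -
  let ?F = "\<lambda>z. {x \<in> V. c x = z}"
  have fin: "finite (?F z)" for z using assms(1) by simp
  have "\<forall>z. \<exists>e. bij_betw e (?F z) {0..<card (?F z)}"
    using ex_bij_betw_finite_nat[OF fin] by blast
  then obtain e where e: "\<And>z. bij_betw (e z) (?F z) {0..<card (?F z)}" by metis
  define f where "f x = (c x, e (c x) x div p)" for x
  have "card {x \<in> V. f x = j} \<le> p" for j
  proof -
    let ?A = "{x \<in> V. f x = j}"
    have sub: "?A \<subseteq> ?F (fst j)" by (auto simp: f_def)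
    have "inj_on (e (fst j)) ?A"
      by (rule inj_on_subset[OF bij_betw_imp_inj_on[OF e] sub])
    then have "card ?A = card (e (fst j) ` ?A)" by (simp add: card_image)
    also have "\<dots> \<le> card {snd j * p..<snd j * p + p}"
    proof (rule card_mono)
      show "e (fst j) ` ?A \<subseteq> {snd j * p..<snd j * p + p}"
        using dividend_less_div_times[OF assms(2)] by (auto simp: f_def add.commute)
    qed simp
    finally show ?thesis by simp
  qed
  moreover have "card (f ` V) \<le> card V div p + card (c ` V)"
  proof -
    have "f x \<in> Sigma (c ` V) (\<lambda>z. {..card (?F z) div p})" if "x \<in> V" for x
    proof -
      have "e (c x) x \<in> {0..<card (?F (c x))}" using e[of "c x"] that by (auto dest: bij_betwE)
      then have "e (c x) x div p \<le> card (?F (c x)) div p" by (intro div_le_mono) auto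
      then show ?thesis using that by (simp add: f_def)
    qed
    then have "f ` V \<subseteq> Sigma (c ` V) (\<lambda>z. {..card (?F z) div p})" by blast
    then have "card (f ` V) \<le> card (Sigma (c ` V) (\<lambda>z. {..card (?F z) div p}))"
      using assms(1) by (intro card_mono finite_SigmaI) auto
    also have "\<dots> = (\<Sum>z\<in>c ` V. card (?F z) div p) + card (c ` V)"
      using assms(1) sum.distrib[of "\<lambda>z. card (?F z) div p" "\<lambda>_. 1" "c ` V"] by simp
    also have "(\<Sum>z\<in>c ` V. card (?F z) div p) \<le> (\<Sum>z\<in>c ` V. card (?F z)) div p"
    proof -
      have "(\<Sum>z\<in>c ` V. card (?F z) div p) * p \<le> (\<Sum>z\<in>c ` V. card (?F z))"
        unfolding sum_distrib_right by (intro sum_mono) simp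
      then show ?thesis using assms(2) by (simp add: less_eq_div_iff_mult_less_eq)
    qed
    also have "(\<Sum>z\<in>c ` V. card (?F z)) = card V"
      using sum.image_gen[OF assms(1), of "\<lambda>_. 1::nat" c] by simp
    finally show ?thesis by simp
  qed
  ultimately show ?thesis by (intro that[of f]) (auto simp: f_def)
qed

text \<open>All vertices of a chunk share a centre. A vertex that tells two of them apart must tell
  one of them from the centre, so at most \<open>p\<close> separator sets cover all splitters of the
  chunk.\<close>

lemma tww_le_clusters:
  fixes G :: "'a::infinite graph" and c :: "'a \<Rightarrow> 'a"
  assumes G: "is_graph G" and p: "0 < p"
    and near: "\<And>x. x \<in> verts G \<Longrightarrow> card (separators G x (c x)) \<le> w"
  shows "tww G \<le> card (verts G) div p + card (c ` verts G) + p * w"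
proof -
  let ?V = "verts G"
  have fin: "finite ?V" using G by (simp add: is_graph_def)
  obtain f :: "'a \<Rightarrow> 'a \<times> nat" where f: "card (f ` ?V) \<le> card ?V div p + card (c ` ?V)"
    "\<And>x. fst (f x) = c x" "\<And>j. card {x \<in> ?V. f x = j} \<le> p"
    using chunk_partition[OF fin p, of c] by blast
  have "card (splitters G {x \<in> ?V. f x = j}) \<le> p * w" for j
  proof -
    let ?F = "{x \<in> ?V. f x = j}"
    have "c x = fst j" if "x \<in> ?F" for x using f(2)[of x] that by auto
    then have "splitters G ?F \<subseteq> (\<Union>x\<in>?F. separators G x (c x))"
      unfolding splitters_def separators_def by fastforce
    then have "card (splitters G ?F) \<le> card (\<Union>x\<in>?F. separators G x (c x))"
      using fin by (intro card_mono) (auto simp: separators_def)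
    also have "\<dots> \<le> (\<Sum>x\<in>?F. card (separators G x (c x)))" using fin by (intro card_UN_le) simp
    also have "\<dots> \<le> card ?F * w" using near sum_bounded_above[of ?F _ w] by fastforce
    also have "\<dots> \<le> p * w" using f(3) by simp
    finally show ?thesis .
  qed
  then have "tww G \<le> card (f ` ?V) + p * w" by (rule tww_le_partition[OF G])
  then show ?thesis using f(1) by linarith
qed

lemma tww_sublinear:
  fixes \<epsilon> :: real
  assumes \<epsilon>: "0 < \<epsilon>"
  obtains m where "\<And>G :: 'a::infinite graph. is_graph G \<Longrightarrow> vcdim G \<le> k \<Longrightarrow> m \<le> card (verts G) \<Longrightarrow>
    tww G \<le> \<epsilon> * card (verts G)"
proof -
  \<comment> \<open>Each of the three summands gets a third of \<epsilon> n: \<open>p\<close>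
    handles n / p, then \<delta> handles p \<delta> n, and the lower bound on the order handles
    \<open>K\<close>. The minimum with 1/2 keeps \<delta> below 1.\<close>
  define p where "p = Suc (nat \<lceil>3 / \<epsilon>\<rceil>)"
  have p: "0 < p" "3 / \<epsilon> \<le> p" unfolding p_def by (simp, use real_nat_ceiling_ge[of "3 / \<epsilon>"] in simp)
  define \<delta> where "\<delta> = min (1 / 2) (\<epsilon> / (3 * p))"
  have \<delta>: "0 < \<delta>" "\<delta> < 1" using \<epsilon> p by (auto simp: \<delta>_def)
  have "\<delta> \<le> \<epsilon> / (3 * p)" by (simp add: \<delta>_def)
  then have p\<delta>: "p * \<delta> \<le> \<epsilon> / 3" using p(1) by (simp add: field_simps)
  obtain K where K: "\<And>(G :: 'a graph) Z. is_graph G \<Longrightarrow> vcdim G \<le> k \<Longrightarrow> Z \<subseteq> verts G \<Longrightarrow>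
      separated G (\<delta> * card (verts G)) Z \<Longrightarrow> card Z \<le> K"
    using packing_bound[OF \<delta>, where k = k and 'a = 'a] by blast
  show ?thesis
  proof (rule that)
    fix G :: "'a graph"
    assume G: "is_graph G" "vcdim G \<le> k" and n: "nat \<lceil>3 * K / \<epsilon>\<rceil> \<le> card (verts G)"
    let ?V = "verts G" and ?n = "card (verts G)"
    have fin: "finite ?V" using G(1) by (simp add: is_graph_def)
    define w where "w = nat \<lfloor>\<delta> * ?n\<rfloor>"
    have w: "w \<le> \<delta> * ?n" using \<delta> by (simp add: w_def)
    \<comment> \<open>A maximal separated set provides the centres: a vertex far from all of them
      could be added.\<close>
    let ?S = "{Z. Z \<subseteq> ?V \<and> separated G (\<delta> * ?n) Z}"
    have "finite ?S" by (rule finite_subset[of _ "Pow ?V"]) (use fin in auto)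
    moreover have "{} \<in> ?S" by (simp add: separated_def)
    then have "?S \<noteq> {}" by blast
    ultimately obtain Z where "Z \<in> ?S" and max': "\<forall>Z'\<in>?S. Z \<subseteq> Z' \<longrightarrow> Z = Z'"
      by (rule finite_has_maximal[THEN bexE]) (rule that)
    then have Z: "Z \<subseteq> ?V" "separated G (\<delta> * ?n) Z" by auto
    have max: "Z = Z'" if "Z' \<subseteq> ?V" "separated G (\<delta> * ?n) Z'" "Z \<subseteq> Z'" for Z'
      using max' that by blast
    have "\<exists>z\<in>Z. card (separators G x z) \<le> w" if x: "x \<in> ?V" for x
    proof (cases "x \<in> Z")
      case True
      then show ?thesis by (intro bexI[of _ x]) (simp_all add: separators_def)
    next
      case False
      then have "\<not> separated G (\<delta> * ?n) (insert x Z)"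
        using max[of "insert x Z"] x Z(1) by blast
      moreover have "separators G x z = separators G z x" for z by (auto simp: separators_def)
      ultimately obtain z where "z \<in> Z" "card (separators G x z) < \<delta> * ?n"
        using Z(2) unfolding separated_def by force
      then show ?thesis by (intro bexI[of _ z]) (auto simp: w_def le_nat_floor)
    qed
    then obtain c where c: "\<And>x. x \<in> ?V \<Longrightarrow> c x \<in> Z" "\<And>x. x \<in> ?V \<Longrightarrow> card (separators G x (c x)) \<le> w"
      by metis
    have "card (c ` ?V) \<le> card Z" using c(1) fin Z(1) by (intro card_mono) (auto intro: finite_subset)
    also have "\<dots> \<le> K" by (rule K[OF G Z])
    finally have "tww G \<le> ?n div p + K + p * w"
      using tww_le_clusters[OF G(1) p(1), of c w] c(2) by fastforce
    then have "real (tww G) \<le> real (?n div p) + K + p * real w"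
      by (metis of_nat_add of_nat_le_iff of_nat_mult)
    moreover have "real (?n div p) \<le> \<epsilon> / 3 * ?n"
    proof -
      have "real (?n div p) \<le> ?n / p" by (rule of_nat_div_le_of_nat)
      also have "\<dots> \<le> ?n / (3 / \<epsilon>)" using p \<epsilon> by (intro divide_left_mono) auto
      finally show ?thesis by (simp add: mult.commute)
    qed
    moreover have "K \<le> \<epsilon> / 3 * ?n"
    proof -
      have "3 * K / \<epsilon> \<le> ?n" using n by linarith
      then show ?thesis using \<epsilon> by (simp add: field_simps)
    qed
    moreover have "p * real w \<le> \<epsilon> / 3 * ?n"
    proof -
      have "p * real w \<le> p * (\<delta> * ?n)" using w by (intro mult_left_mono) auto
      also have "\<dots> = p * \<delta> * ?n" by simp
      also have "\<dots> \<le> \<epsilon> / 3 * ?n" using p\<delta> by (intro mult_right_mono) auto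
      finally show ?thesis .
    qed
    ultimately show "real (tww G) \<le> \<epsilon> * ?n" by linarith
  qed
qed

text \<open>The bound is the maximum of twin-width over the members of each order, which is finite
  because twin-width is at most the order. Inserting 0 covers orders without members.\<close>

lemma sublinear_bound_if_bounded_vcdim:
  fixes C :: "'a::infinite graph set"
  assumes C: "\<And>G. G \<in> C \<Longrightarrow> is_graph G" and k: "\<And>G. G \<in> C \<Longrightarrow> vcdim G \<le> k"
  shows "\<exists>g :: nat \<Rightarrow> real. (\<forall>n. 0 \<le> g n) \<and> g \<in> o(\<lambda>n. real n) \<and>
    (\<forall>G\<in>C. real (tww G) \<le> g (card (verts G)))"
proof -
  define T where "T n = insert 0 {tww G | G. G \<in> C \<and> card (verts G) = n}" for n
  have "T n \<subseteq> {..n}" for n using tww_le_card C by (auto simp: T_def)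
  then have fin: "finite (T n)" for n using finite_subset by blast
  define g where "g n = real (Max (T n))" for n
  have "\<forall>G\<in>C. real (tww G) \<le> g (card (verts G))"
    using fin unfolding g_def by (auto simp: T_def intro!: Max_ge)
  moreover have "g \<in> o(\<lambda>n. real n)"
  proof (rule landau_o.smallI)
    fix \<epsilon> :: real assume \<epsilon>: "0 < \<epsilon>"
    obtain m where m: "\<And>G :: 'a graph. is_graph G \<Longrightarrow> vcdim G \<le> k \<Longrightarrow> m \<le> card (verts G) \<Longrightarrow>
        tww G \<le> \<epsilon> * card (verts G)" using tww_sublinear[OF \<epsilon>, where k = k and 'a = 'a] by blast
    have "g n \<le> \<epsilon> * n" if "m \<le> n" for n
    proof -
      have "Max (T n) \<in> T n" using fin by (intro Max_in) (auto simp: T_def)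
      then show ?thesis using m C k that \<epsilon> by (auto simp: T_def g_def)
    qed
    then show "\<forall>\<^sub>F n in sequentially. norm (g n) \<le> \<epsilon> * norm (real n)"
      unfolding eventually_sequentially by (auto simp: g_def)
  qed
  ultimately show ?thesis by (intro exI[of _ g]) (auto simp: g_def)
qed

subsection \<open>Graphs of large VC-dimension\<close>

text \<open>The new part contains both \<open>a X\<close> and \<open>a X'\<close>, so every
  \<open>b Y\<close> that tells them apart lies in a red neighbour unless it was swallowed too.
  Before the contraction the \<open>b Y\<close> had distinct parts: at most two were swallowed, one
  from \<open>u\<close> and one from \<open>v\<close>, and the others give distinct neighbours.
  Since \<open>a\<close> and \<open>b\<close> are arbitrary, the roles can be exchanged.\<close>

lemma red_degree_after_collision:
  assumes fin: "finite (verts G)" "finite I" and V: "a ` I \<subseteq> verts G" "b ` I \<subseteq> verts G"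
    and uv: "u \<in> p ` verts G" "v \<in> p ` verts G" and w: "w \<notin> p ` verts G"
    and inj: "inj_on (p \<circ> a) I" "inj_on (p \<circ> b) I"
    and X: "X \<in> I" "X' \<in> I" "X \<noteq> X'" "merge p u v w (a X) = merge p u v w (a X')"
    and r: "r \<le> card {Y \<in> I. adj G (a X) (b Y) \<noteq> adj G (a X') (b Y)}"
  shows "r \<le> red_degree (quotient_trigraph G (merge p u v w)) w + 2"
    "w \<in> tverts (quotient_trigraph G (merge p u v w))"
proof -
  let ?q = "merge p u v w" and ?V = "verts G"
  let ?D = "{Y \<in> I. adj G (a X) (b Y) \<noteq> adj G (a X') (b Y)}"
  let ?D' = "{Y \<in> ?D. ?q (b Y) \<noteq> w}" and ?W = "{Y \<in> ?D. ?q (b Y) = w}"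
  have q: "?q x = p x" if "?q x \<noteq> w" for x
    using that by (auto simp: merge_def split: if_splits)
  have aX: "a X \<in> ?V" "a X' \<in> ?V" using V X by auto
  have "p (a X) \<noteq> p (a X')" using inj(1) X by (auto simp: inj_on_def)
  then have qw: "?q (a X) = w" "?q (a X') = w" using q[of "a X"] q[of "a X'"] X(4) by metis+
  show "w \<in> tverts (quotient_trigraph G ?q)" using imageI[OF aX(1), of ?q] qw(1) by simp
  have "card ?W \<le> 2"
  proof -
    have "p (b Y) \<in> {u, v}" if "Y \<in> ?W" for Y
    proof -
      have "p (b Y) \<noteq> w" using that w V by auto
      then show ?thesis using that by (auto simp: merge_def split: if_splits)
    qed
    then have "(p \<circ> b) ` ?W \<subseteq> {u, v}" by auto
    then have "card ((p \<circ> b) ` ?W) \<le> card {u, v}" by (intro card_mono) auto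
    moreover have "inj_on (p \<circ> b) ?W" by (rule inj_on_subset[OF inj(2)]) auto
    moreover have "card {u, v} \<le> 2" by (simp add: card_insert_if)
    ultimately show ?thesis using card_image[of "p \<circ> b" ?W] by linarith
  qed
  moreover have "card ?D' \<le> red_degree (quotient_trigraph G ?q) w"
  proof -
    have "{w, ?q (b Y)} \<in> red (quotient_trigraph G ?q)" if Y: "Y \<in> ?D'" for Y
    proof -
      have bY: "b Y \<in> ?V" using V Y by auto
      have "\<not> complete_between G ?q w (?q (b Y))" "\<not> empty_between G ?q w (?q (b Y))"
        using Y bY aX qw unfolding complete_between_def empty_between_def by blast+
      moreover have "w \<in> ?q ` ?V" using imageI[OF aX(1), of ?q] qw(1) by simp
      ultimately show ?thesis using Y bY by (auto simp: red_quotient_iff)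
    qed
    then have sub: "(\<lambda>Y. ?q (b Y)) ` ?D' \<subseteq> {y \<in> ?q ` ?V. {w, y} \<in> red (quotient_trigraph G ?q)}"
      using V(2) by blast
    have "inj_on (\<lambda>Y. ?q (b Y)) ?D'"
    proof (rule inj_onI)
      fix Y Z assume YZ: "Y \<in> ?D'" "Z \<in> ?D'" "?q (b Y) = ?q (b Z)"
      then have "p (b Y) = p (b Z)" using q[of "b Y"] q[of "b Z"] by auto
      then show "Y = Z" using inj(2) YZ by (auto simp: inj_on_def)
    qed
    then have "card ?D' = card ((\<lambda>Y. ?q (b Y)) ` ?D')" by (simp add: card_image)
    also have "\<dots> \<le> card {y \<in> ?q ` ?V. {w, y} \<in> red (quotient_trigraph G ?q)}"
      using fin sub by (intro card_mono) auto
    finally show ?thesis by (simp add: red_degree_quotient)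
  qed
  moreover have "card ?D = card ?D' + card ?W"
  proof -
    have "card ?D = card (?D' \<union> ?W)" by (rule arg_cong[where f = card]) blast
    also have "\<dots> = card ?D' + card ?W"
      using fin(2) by (intro card_Un_disjoint) auto
    finally show ?thesis .
  qed
  ultimately show "r \<le> red_degree (quotient_trigraph G ?q) w + 2" using r by linarith
qed

text \<open>Look at the first contraction that puts two vertices \<open>a X\<close>, \<open>a X'\<close> (or two vertices \<open>b X\<close>,
  \<open>b X'\<close>) into the same part: up to then the other side is still spread over different parts,
  so the new part has many red neighbours. Adjacency inside each side plays no role.\<close>

lemma tww_ge_of_distinct_rows_cols:
  fixes G :: "'a::infinite graph"
  assumes G: "is_graph G" and I: "finite I" "1 < card I"
    and V: "a ` I \<subseteq> verts G" "b ` I \<subseteq> verts G" and inj: "inj_on a I" "inj_on b I"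
    and rows: "\<And>X X'. X \<in> I \<Longrightarrow> X' \<in> I \<Longrightarrow> X \<noteq> X' \<Longrightarrow>
      r \<le> card {Y \<in> I. adj G (a X) (b Y) \<noteq> adj G (a X') (b Y)}"
    and cols: "\<And>X X'. X \<in> I \<Longrightarrow> X' \<in> I \<Longrightarrow> X \<noteq> X' \<Longrightarrow>
      r \<le> card {Y \<in> I. adj G (b X) (a Y) \<noteq> adj G (b X') (a Y)}"
  shows "r \<le> tww G + 2"
proof (rule ccontr)
  assume small: "\<not> r \<le> tww G + 2"
  have fin: "finite (verts G)" "verts G \<noteq> {}" using G by (auto simp: is_graph_def)
  let ?n = "card (verts G)"
  have n: "1 \<le> ?n" using fin by (simp add: Suc_le_eq card_gt_0_iff)
  obtain S where "is_d_sequence (tww G) G S" using tww_sequence[OF G] .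
  then have S: "S ?n = quotient_trigraph G (\<lambda>x. x)"
     "\<exists>x. S 1 = \<lparr>tverts = {x}, black = {}, red = {}\<rparr>"
     "\<And>s. s \<in> {1..<?n} \<Longrightarrow> contraction (S (s + 1)) (S s)"
     "\<And>s v. s \<in> {1..?n} \<Longrightarrow> v \<in> tverts (S s) \<Longrightarrow> red_degree (S s) v \<le> tww G"
    unfolding is_d_sequence_def contraction_sequence_def trigraph_of_eq_quotient[OF G] by auto
  \<comment> \<open>Downward induction along the sequence: a first collision would force too large a
    red degree, so none ever happens. This contradicts the single part at the end.\<close>
  have "\<exists>p. S 1 = quotient_trigraph G p \<and> inj_on (p \<circ> a) I \<and> inj_on (p \<circ> b) I"
    using n
  proof (induction rule: inc_induct)
    case base
    show ?case using S(1) inj by (intro exI[of _ "\<lambda>x. x"]) (simp add: comp_def)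
  next
    case (step s)
    then obtain p where p: "S (Suc s) = quotient_trigraph G p" "inj_on (p \<circ> a) I" "inj_on (p \<circ> b) I"
      by blast
    have "contraction (quotient_trigraph G p) (S s)" using S(3)[of s] p(1) step.hyps by simp
    then obtain u v w where uv: "u \<in> p ` verts G" "v \<in> p ` verts G" "u \<noteq> v" "w \<notin> p ` verts G"
      "S s = contract (quotient_trigraph G p) u v w"
      unfolding contraction_def tverts_quotient by blast
    let ?q = "merge p u v w"
    have Ss: "S s = quotient_trigraph G ?q" using contract_quotient uv by metis
    have deg: "red_degree (quotient_trigraph G ?q) x \<le> tww G"
      if "x \<in> tverts (quotient_trigraph G ?q)" for x
      using S(4)[of s x] that step.hyps by (simp add: Ss)
    have "inj_on (?q \<circ> a) I"
    proof (rule inj_onI, rule ccontr)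
      fix X X' assume X: "X \<in> I" "X' \<in> I" "(?q \<circ> a) X = (?q \<circ> a) X'" "X \<noteq> X'"
      then have "?q (a X) = ?q (a X')" by simp
      from red_degree_after_collision[OF fin(1) I(1) V uv(1,2,4) p(2,3) X(1,2,4) this rows[OF X(1,2,4)]]
      show False using deg[of w] small by linarith
    qed
    moreover have "inj_on (?q \<circ> b) I"
    proof (rule inj_onI, rule ccontr)
      fix X X' assume X: "X \<in> I" "X' \<in> I" "(?q \<circ> b) X = (?q \<circ> b) X'" "X \<noteq> X'"
      then have "?q (b X) = ?q (b X')" by simp
      from red_degree_after_collision[OF fin(1) I(1) V(2,1) uv(1,2,4) p(3,2) X(1,2,4) this cols[OF X(1,2,4)]]
      show False using deg[of w] small by linarith
    qed
    ultimately show ?case using Ss by blast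
  qed
  then obtain p where p: "S 1 = quotient_trigraph G p" "inj_on (p \<circ> a) I" by blast
  obtain x where "S 1 = \<lparr>tverts = {x}, black = {}, red = {}\<rparr>" using S(2) by blast
  then have "tverts (quotient_trigraph G p) = {x}" using p(1) by (metis trigraph.select_convs(1))
  then have "(p \<circ> a) ` I \<subseteq> {x}" using V(1) by auto
  then have "card ((p \<circ> a) ` I) \<le> card {x}" by (intro card_mono) auto
  also have "card {x} = 1" by simp
  finally show False using I(2) card_image[OF p(2)] by linarith
qed

section \<open>The parity matrix realised on a shattered set\<close>

lemma parity_separation:
  assumes "X \<subseteq> U" "X' \<subseteq> U" "X \<noteq> X'" "finite U"
  shows "2 ^ card U \<le> 2 * card {Y \<in> Pow U. odd (card (X \<inter> Y)) \<noteq> odd (card (X' \<inter> Y))}"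
proof -
  let ?D = "{Y \<in> Pow U. odd (card (X \<inter> Y)) \<noteq> odd (card (X' \<inter> Y))}"
  obtain i where i: "i \<in> U" "i \<in> X \<longleftrightarrow> i \<notin> X'" using assms by blast
  \<comment> \<open>Toggling an element \<open>i\<close> of exactly one of \<open>X\<close>,
    \<open>X'\<close> flips exactly one of the two parities, so \<open>h\<close> injects the sets
    where they agree into those where they differ.\<close>
  define h where "h Y = (if i \<in> Y then Y - {i} else insert i Y)" for Y
  have flip: "odd (card (Z \<inter> h Y)) \<longleftrightarrow> (i \<in> Z) \<noteq> odd (card (Z \<inter> Y))" if "Z \<subseteq> U" for Z Y
  proof (cases "i \<in> Z")
    case True
    have fin: "finite (Z \<inter> Y')" for Y' using that assms(4) by (auto intro: finite_subset)
    show ?thesis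
    proof (cases "i \<in> Y")
      case True
      then have "Z \<inter> Y = insert i (Z \<inter> h Y)" "i \<notin> Z \<inter> h Y" using \<open>i \<in> Z\<close> by (auto simp: h_def)
      then show ?thesis using fin \<open>i \<in> Z\<close> by simp
    next
      case False
      then have "Z \<inter> h Y = insert i (Z \<inter> Y)" "i \<notin> Z \<inter> Y" using \<open>i \<in> Z\<close> by (auto simp: h_def)
      then show ?thesis using fin \<open>i \<in> Z\<close> by simp
    qed
  next
    case False
    then have "Z \<inter> h Y = Z \<inter> Y" by (auto simp: h_def)
    then show ?thesis using False by simp
  qed
  have "inj h" unfolding h_def inj_def by (auto split: if_splits)
  then have "card (Pow U - ?D) = card (h ` (Pow U - ?D))"
    by (intro card_image[symmetric]) (auto intro: inj_on_subset)
  also have "\<dots> \<le> card ?D"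
  proof (rule card_mono)
    show "h ` (Pow U - ?D) \<subseteq> ?D"
    proof
      fix Z assume "Z \<in> h ` (Pow U - ?D)"
      then obtain Y where Y: "Z = h Y" "Y \<subseteq> U" "odd (card (X \<inter> Y)) = odd (card (X' \<inter> Y))" by auto
      then have "h Y \<subseteq> U" using i(1) by (auto simp: h_def)
      then show "Z \<in> ?D" using Y flip[OF assms(1), of Y] flip[OF assms(2), of Y] i(2) by auto
    qed
  qed (use assms(4) in simp)
  finally have "card (Pow U - ?D) \<le> card ?D" .
  moreover have "card (Pow U - ?D) = card (Pow U) - card ?D"
    using assms(4) by (intro card_Diff_subset) auto
  moreover have "card (Pow U) = 2 ^ card U" using assms(4) by (simp add: card_Pow)
  ultimately show ?thesis by linarith
qed

lemma shattered_vcdim_set: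
  assumes "is_graph G"
  obtains S where "S \<subseteq> verts G" "shattered (neighbourhood G ` verts G) S" "card S = vcdim G"
proof -
  let ?A = "{S. S \<subseteq> verts G \<and> shattered (neighbourhood G ` verts G) S}"
  have "finite ?A" "{} \<in> ?A" using assms by (auto simp: is_graph_def shattered_def)
  then have "Max (card ` ?A) \<in> card ` ?A" by (intro Max_in) auto
  then show ?thesis using that by (auto simp: vcdim_def vc_dimension_def)
qed

text \<open>Shattering supplies a vertex for every prescribed row over the labelled set
  \<open>B\<close>, in particular for the parity rows. Restricting to these vertices keeps the order
  within a factor 2 of 2^m, which makes the lower bound linear.\<close>

lemma large_tww_if_large_vcdim:
  fixes C :: "'a::infinite graph set"
  assumes C: "hereditary C" and G: "G \<in> C" "2 ^ m \<le> vcdim G" and m: "0 < m"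
  obtains H where "H \<in> C" "2 ^ m \<le> card (verts H)" "card (verts H) \<le> 2 * 2 ^ m"
    "2 ^ m \<le> 2 * tww H + 4"
proof -
  let ?I = "Pow {..<m}"
  have cI: "card ?I = 2 ^ m" by (simp add: card_Pow)
  have g: "is_graph G" using C G(1) by (simp add: hereditary_def)
  obtain S where S: "S \<subseteq> verts G" "shattered (neighbourhood G ` verts G) S" "card S = vcdim G"
    using shattered_vcdim_set[OF g] .
  obtain B where B: "B \<subseteq> S" "card B = 2 ^ m" "finite B"
    using obtain_subset_with_card_n[of "2 ^ m" S] G(2) S(3) by auto
  then obtain b where b: "bij_betw b ?I B"
    using finite_same_card_bij[of ?I B] cI by auto
  have bB: "b Y \<in> B" if "Y \<in> ?I" for Y using b that by (auto dest: bij_betwE)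
  have injb: "inj_on b ?I" using b by (rule bij_betw_imp_inj_on)
  have "\<exists>v\<in>verts G. \<forall>Y\<in>?I. adj G v (b Y) \<longleftrightarrow> odd (card (X \<inter> Y))" for X
  proof -
    let ?A = "b ` {Y \<in> ?I. odd (card (X \<inter> Y))}"
    have "?A \<subseteq> S" using bB B(1) by blast
    then obtain v where v: "v \<in> verts G" "neighbourhood G v \<inter> S = ?A"
      using S(2) unfolding shattered_def by blast
    have "adj G v (b Y) \<longleftrightarrow> odd (card (X \<inter> Y))" if Y: "Y \<in> ?I" for Y
    proof -
      have "b Y \<in> S" "b Y \<in> verts G" using bB[OF Y] B(1) S(1) by auto
      then have "adj G v (b Y) \<longleftrightarrow> b Y \<in> ?A" unfolding v(2)[symmetric] by (simp add: neighbourhood_def)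
      also have "\<dots> \<longleftrightarrow> odd (card (X \<inter> Y))"
        using Y inj_on_image_mem_iff[OF injb Y, of "{Y \<in> ?I. odd (card (X \<inter> Y))}"] by auto
      finally show ?thesis .
    qed
    then show ?thesis using v(1) by blast
  qed
  then obtain a where a: "\<And>X. a X \<in> verts G"
    \<comment> \<open>Some \<open>a X\<close> may coincide with some \<open>b Y\<close>; only
      injectivity on each side is required later.\<close>
    "\<And>X Y. Y \<in> ?I \<Longrightarrow> adj G (a X) (b Y) \<longleftrightarrow> odd (card (X \<inter> Y))" by metis
  define W where "W = a ` ?I \<union> B"
  have W: "W \<subseteq> verts G" "B \<subseteq> W" using a(1) B(1) S(1) by (auto simp: W_def)
  have "B \<noteq> {}" using B(2) by auto
  define H where "H = induced G W"
  have H: "H \<in> C" using C G(1) W \<open>B \<noteq> {}\<close> unfolding hereditary_def H_def by blast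
  then have gH: "is_graph H" using C by (simp add: hereditary_def)
  have vH: "verts H = W" by (simp add: H_def induced_def)
  have adjH: "adj H (a X) (b Y) \<longleftrightarrow> odd (card (X \<inter> Y))" if "X \<in> ?I" "Y \<in> ?I" for X Y
    using a(2)[OF that(2), of X] that bB by (auto simp: H_def induced_def W_def)
  have finW: "finite W" using B(3) by (simp add: W_def)
  have rows: "2 ^ m \<le> 2 * card {Y \<in> ?I. adj H (a X) (b Y) \<noteq> adj H (a X') (b Y)}"
    if "X \<in> ?I" "X' \<in> ?I" "X \<noteq> X'" for X X'
  proof -
    have "{Y \<in> ?I. adj H (a X) (b Y) \<noteq> adj H (a X') (b Y)} =
        {Y \<in> ?I. odd (card (X \<inter> Y)) \<noteq> odd (card (X' \<inter> Y))}"
      using adjH that by blast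
    then show ?thesis using parity_separation[of X "{..<m}" X'] that by simp
  qed
  have cols: "2 ^ m \<le> 2 * card {Y \<in> ?I. adj H (b X) (a Y) \<noteq> adj H (b X') (a Y)}"
    if "X \<in> ?I" "X' \<in> ?I" "X \<noteq> X'" for X X'
  proof -
    have "adj H (b Z) (a Y) \<longleftrightarrow> odd (card (Z \<inter> Y))" if "Z \<in> ?I" "Y \<in> ?I" for Z Y
      using adjH[OF that(2,1)] by (simp add: insert_commute Int_commute)
    then have "{Y \<in> ?I. adj H (b X) (a Y) \<noteq> adj H (b X') (a Y)} =
        {Y \<in> ?I. odd (card (X \<inter> Y)) \<noteq> odd (card (X' \<inter> Y))}"
      using that by blast
    then show ?thesis using parity_separation[of X "{..<m}" X'] that by simp
  qed
  have half: "2 * 2 ^ (m - 1) = (2 ^ m :: nat)" using m by (simp add: power_eq_if)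
  \<comment> \<open>Shattering does not say that the chosen vertices differ; equal vertices would
    have equal rows, against \<open>rows\<close>.\<close>
  have inja: "inj_on a ?I"
  proof (rule inj_onI, rule ccontr)
    fix X X' assume "X \<in> ?I" "X' \<in> ?I" "a X = a X'" "X \<noteq> X'"
    with rows[of X X'] show False by simp
  qed
  have "2 ^ (m - 1) \<le> tww H + 2"
  proof (rule tww_ge_of_distinct_rows_cols[OF gH _ _ _ _ inja injb])
    show "1 < card ?I" using m one_less_power[of "2 :: nat" m] by (simp add: cI)
    show "a ` ?I \<subseteq> verts H" "b ` ?I \<subseteq> verts H" using bB by (auto simp: vH W_def)
    show "2 ^ (m - 1) \<le> card {Y \<in> ?I. adj H (a X) (b Y) \<noteq> adj H (a X') (b Y)}"
      if "X \<in> ?I" "X' \<in> ?I" "X \<noteq> X'" for X X'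
      using rows[OF that] half by linarith
    show "2 ^ (m - 1) \<le> card {Y \<in> ?I. adj H (b X) (a Y) \<noteq> adj H (b X') (a Y)}"
      if "X \<in> ?I" "X' \<in> ?I" "X \<noteq> X'" for X X'
      using cols[OF that] half by linarith
  qed simp
  then have "2 ^ m \<le> 2 * tww H + 4" using half by linarith
  moreover have "2 ^ m \<le> card (verts H)"
    unfolding vH using card_mono[OF finW W(2)] B(2) by simp
  moreover have "card (verts H) \<le> 2 * 2 ^ m"
  proof -
    have "card W \<le> card (a ` ?I) + card B" unfolding W_def by (rule card_Un_le)
    also have "card (a ` ?I) \<le> 2 ^ m" using card_image_le[of ?I a] cI by simp
    finally show ?thesis using B(2) by (simp add: vH)
  qed
  ultimately show ?thesis using that H by blast
qed

lemma bounded_vcdim_if_sublinear_bound: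
  fixes C :: "'a::infinite graph set" and g :: "nat \<Rightarrow> real"
  assumes C: "hereditary C" and g: "g \<in> o(\<lambda>n. real n)"
    and tww: "\<And>G. G \<in> C \<Longrightarrow> real (tww G) \<le> g (card (verts G))"
  shows "\<exists>k. \<forall>G\<in>C. vcdim G \<le> k"
proof -
  \<comment> \<open>With M = 2^m, the order at most 2 M gives twin-width at most M / 8, whereas the
    parity matrix gives at least M / 2 - 2. These clash once M is at least 16.\<close>
  from landau_o.smallD[OF g, of "1 / 16"] obtain N where
    N: "\<And>n. N \<le> n \<Longrightarrow> norm (g n) \<le> 1 / 16 * norm (real n)"
    by (auto simp: eventually_sequentially)
  \<comment> \<open>The summand \<open>N\<close> makes the order of \<open>H\<close> large enough
    for the estimate on \<open>g\<close>, and 4 ensures 16 \<le> 2^m.\<close>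
  define m where "m = N + 4"
  have "N < 2 ^ N" by (rule less_exp)
  moreover have "(2::nat) ^ m = 16 * 2 ^ N" by (simp add: m_def power_add)
  moreover have "(1::nat) \<le> 2 ^ N" by simp
  ultimately have m: "N \<le> 2 ^ m" "16 \<le> (2::nat) ^ m" by linarith+
  have "vcdim G < 2 ^ m" if G: "G \<in> C" for G
  proof (rule ccontr)
    assume "\<not> ?thesis"
    then have "2 ^ m \<le> vcdim G" by simp
    then obtain H where H: "H \<in> C" "2 ^ m \<le> card (verts H)" "card (verts H) \<le> 2 * 2 ^ m"
      "2 ^ m \<le> 2 * tww H + 4"
      using large_tww_if_large_vcdim[OF C G, of m] by (auto simp: m_def)
    have "real (tww H) \<le> 1 / 16 * real (card (verts H))"
      using tww[OF H(1)] N[of "card (verts H)"] H(2) m(1) by simp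
    then have "16 * tww H \<le> card (verts H)" by linarith
    moreover define M :: nat where "M = 2 ^ m"
    ultimately show False using H(3,4)[folded M_def] m(2)[folded M_def] by linarith
  qed
  then show ?thesis by (meson less_imp_le)
qed

theorem mainTheorem3:
  fixes C :: "'a::infinite graph set"
  assumes "hereditary C"
  shows "(\<exists>g :: nat \<Rightarrow> real. (\<forall>n. 0 \<le> g n) \<and> g \<in> o(\<lambda>n. real n) \<and>
            (\<forall>G\<in>C. real (tww G) \<le> g (card (verts G))))
         \<longleftrightarrow> (\<exists>k :: nat. \<forall>G\<in>C. vcdim G \<le> k)"
proof
  assume "\<exists>g :: nat \<Rightarrow> real. (\<forall>n. 0 \<le> g n) \<and> g \<in> o(\<lambda>n. real n) \<and>
    (\<forall>G\<in>C. real (tww G) \<le> g (card (verts G)))"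
  then show "\<exists>k. \<forall>G\<in>C. vcdim G \<le> k"
    using bounded_vcdim_if_sublinear_bound[OF assms] by blast
next
  assume "\<exists>k. \<forall>G\<in>C. vcdim G \<le> k"
  then obtain k where "\<And>G. G \<in> C \<Longrightarrow> vcdim G \<le> k" by blast
  moreover have "\<And>G. G \<in> C \<Longrightarrow> is_graph G" using assms by (simp add: hereditary_def)
  ultimately show "\<exists>g :: nat \<Rightarrow> real. (\<forall>n. 0 \<le> g n) \<and> g \<in> o(\<lambda>n. real n) \<and>
    (\<forall>G\<in>C. real (tww G) \<le> g (card (verts G)))"
    by (intro sublinear_bound_if_bounded_vcdim)
qed

end
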